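(* Let $P(a_1,\dots,a_n)$ be an unoriented, reduced pretzel diagram of an oriented pretzel link $L$, with parameters $r,s,z,\lambda,\Sigma$. Let $S=\operatorname{span}(V(L))$ be the span of the Jones polynomial of $L$. Since the span does not depend on the order of the entries, assume $a_1\ge a_2\ge\dots\ge a_n$. Then: 1. $S=\Sigma+z$ if $z>0$. In the remaining cases assume $z=0$. 2. $S=\Sigma-\min\{1,r+\lambda,s-\lambda\}+1$ if $r+\lambda\ne 1$ and $s-\lambda\ne 1$, except the case $P(1,-1)$, for which $S=2$. In the remaining cases consider $z=0$ and $r+\lambda=1$ (by taking the mirror image, which does not change $S$, the case $s-\lambda=1$ can be reduced to this one). 3. In this item assume $r>1$. (3.1) $S=\Sigma-1$ if $(r,\lambda,s)\ne(2,-1,0)$. In the rest of the cases in this item assume $(r,\lambda,s)=(2,-1,0)$. (3.2) $S=\Sigma-2=2$ if $a_2=2$ and $a_1=2$. (3.3) $S=\Sigma-4=1$ if $a_2=2$ and $a_1=3$. (3.4) $S=\Sigma-3=a_1-1$ if $a_2=2$ and $a_1>3$. (3.5) $S=\Sigma-2=a_1+a_2-2$ if $a_2>2$. 4. In this item assume $r=1$ and $s\le 1$ (so $a_1>1$ and, if $s=1$, $-1>a_2$). (4.1) $S=1=\Sigma-a_1+1$ if $s=0$. (4.2) $S=2$ if $s=1$ and $|a_1+a_2|=0$. (4.3) $S=1$ if $s=1$ and $|a_1+a_2|=1$. (4.4) $S=1+|a_1+a_2|$ if $s=1$ and $|a_1+a_2|>1$. 5. In this item assume $r=1$ and $s>1$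 (so $a_1>1$ and $-1>a_2\ge a_3\ge\cdots$). (5.1) $S=\Sigma-\min\{a_1,|a_2|-1\}$ if $a_1\ne|a_2|-1$. (5.2) $S=\Sigma-\min\{|a_2|,|a_3|-1\}$ if $a_1=|a_2|-1$ and $|a_2|\ne|a_3|-1$. (5.3) $S=2a_1$ if $s=2$, $a_1=|a_2|-1$ and $|a_2|=|a_3|-1$, except the case $P(2,-3,-4)$, for which $S=3$. (5.4) $S=\Sigma-a_1-3$ if $a_1=|a_2|-1$, $|a_2|=|a_3|-1$ and $|a_3|<|a_4|-1$, except the cases $P(2,-3,-4,a_4)$ with $a_4<-6$, for which $S=\Sigma-6$. (5.5) $S=\Sigma-a_1-2$ if $a_1=|a_2|-1$, $|a_2|=|a_3|-1$ and $|a_3|=|a_4|-1$. (5.6) $S=\Sigma-a_1-1$ if $a_1=|a_2|-1$, $|a_2|=|a_3|-1$ and $|a_3|=|a_4|$. 6. In this item assume $r=0$ and $a_2\ne-2$ (so $a_1=1$, and $a_2<-2$ or $s=0$). (6.1) $S=\Sigma+1=1$ if $s=0$. (6.2) $S=\Sigma=-a_2$ if $s=1$. (6.3) $S=\Sigma-2$ if $s=2$. (6.4) $S=\Sigma-1$ if $s>2$. 7. In this item assume $r=0$ and $a_2=-2$ (so $a_1=1$ and $a_2=-2$). (7.1) $S=\Sigma-1=1$ if $s=1$. (7.2) $S=\Sigma-2=2$ if $s=2$ and $a_3=-2$. (7.3) $S=\Sigma-4=1$ if $s=2$ and $a_3=-3$. (7.4) $S=\Sigma-3=-1-a_3$ if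 $s=2$ and $a_3<-3$. (7.5) $S=\Sigma-1=3-a_4$ if $s=3$ and $a_3=-2$. (7.6) $S=\Sigma-2=6$ if $s=3$, $a_3=-3$ and $a_4=-3$. (7.7) $S=\Sigma-6=3$ if $s=3$, $a_3=-3$ and $a_4=-4$. (7.8) $S=\Sigma-3=2-a_4$ if $s=3$, $a_3=-3$ and $a_4<-4$. (7.9) $S=\Sigma-2=-a_3-a_4$ if $s=3$ and $a_3<-3$. (7.10) $S=\Sigma-1$ if $s>3$ and $a_3=-2$. (7.11) $S=\Sigma-2$ if $s>3$, $a_3=-3$ and $a_4=-3$. (7.12) $S=\Sigma-3$ if $s>3$, $a_3=-3$, $a_4=-4$ and $a_5=-4$. (7.13) $S=\Sigma-4$ if $s>3$, $a_3=-3$, $a_4=-4$ and $a_5=-5$. (7.14) $S=\Sigma-5$ if $s>3$, $a_3=-3$, $a_4=-4$ and $a_5<-5$, except for the pretzel $P(1,-2,-3,-4,a_5)$ with $a_5<-6$, for which $S=\Sigma-6$. (7.15) $S=\Sigma-3$ if $s>3$, $a_3=-3$ and $a_4<-4$. (7.16) $S=\Sigma-2$ if $s>3$ and $a_3<-3$.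
   Context: Pretzel diagrams. For $n\ge 1$ and integers $a_1,\dots,a_n$, $P(a_1,\dots,a_n)$ is the unoriented link diagram in the plane made of $n$ vertical two-strand columns placed side by side. The $i$-th column consists of two vertical strands twisted around each other with $|a_i|$ crossings stacked vertically (no crossings if $a_i=0$), all of the same kind: if $a_i>0$ the overstrand of each crossing goes from bottom-left to top-right, if $a_i<0$ from bottom-right to top-left. The top-right (resp. bottom-right) end of column $i$ is joined by an arc to the top-left (resp. bottom-left) end of column $i+1$ for $1\le i<n$, and the top-left (resp. bottom-left) end of column $1$ is joined by an outer arc to the top-right (resp. bottom-right) end of column $n$. A pretzel link is a link in $S^3$ that has a pretzel diagram. Parameters. For $P(a_1,\dots,a_n)$: $r$ is the number of $a_i>1$, $s$ the number of $a_i<-1$, $z$ the number of $a_i=0$, $\alpha$ the number of $a_i=1$, $\beta$ the number of $a_i=-1$, $\lambda=\alpha-\beta$, and $\Sigma=\sum_{|a_i|>1}|a_i|$. Reduced. A pretzel diagram $P$ is reduced if $P=P(1,-1)$, or if it satisfies both: (i) $\alpha\beta=0$; (ii) if $z\neq 0$ then $\alpha=\beta=0$. Mirror image. The mirror image of the link of $P(a_1,\dots,a_n)$ is the link of $P(-a_1,\dots,-a_n)$; this interchanges $r$ and $s$ and replaces $\lambda$ by $-\lambda$. Jones polynomial. $V(L)$ is the Jones polynomial of the oriented link $L$ normalized by $V(\text{unknot})=-t^{-1/2}-t^{1/2}$; thus $V(L)=(-t^{-1/2}-t^{1/2})V_1(L)$, where $V_1$ is the usual Jones polynomial with $V_1(\text{unknot})=1$.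 The span of a Laurent polynomial (in $t^{1/2}$) is its highest degree in $t$ minus its lowest degree in $t$; hence $\operatorname{span}(V(L))=1+\operatorname{span}(V_1(L))$.
   Formalization: The exceptions in (5.4) and (7.14) are taken to hold for any diagram whose entries begin (2,-3,-4,a_4) with a_4<-6, resp. (1,-2,-3,-4,a_5) with a_5<-6, further columns allowed; as printed the claim fails, e.g. P(2,-3,-4,-7,-7) and P(1,-2,-3,-4,-7,-7) have S=17, not 18. *)

theory Defs
  imports Complex_Main "HOL-Library.Poly_Mapping" "HOL-Library.Multiset"
begin

section \<open>Laurent polynomials in fractional powers of t\<close>

text \<open>
  The finitely supported map \<open>p\<close> stands for the sum of \<open>lookup p q * t^q\<close> over the
  rational exponents \<open>q\<close>; multiplication is convolution.  Rational exponents allow both the bracket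
  variable \<open>A = t^(-1/4)\<close> and \<open>t^(1/2)\<close> to be monomials.
\<close>

type_synonym laurent = "rat \<Rightarrow>\<^sub>0 int"

definition t_pow :: "rat \<Rightarrow> laurent" where
  "t_pow q = Poly_Mapping.single q 1"

definition degree_span :: "laurent \<Rightarrow> rat" where
  "degree_span p = Max (Poly_Mapping.keys p) - Min (Poly_Mapping.keys p)"


section \<open>Link diagrams\<close>

text \<open>
  A diagram is presented by marked points on it, each of which lies on a strand running vertically
  there.  It is built from crossings, given by the marked points at their four corners, and
  from crossingless arcs (local maxima or minima) joining two marked points.  A crossing has one strand from
  \<open>sw\<close> to \<open>ne\<close> and one from \<open>se\<close> to \<open>nw\<close>; it is \<open>rising\<close> if the former is the overstrand.
  Every component of the diagram contains a marked point.
\<close>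

datatype 'p crossing = Crossing (sw: 'p) (se: 'p) (nw: 'p) (ne: 'p) (rising: bool)

record 'p diagram =
  points :: "'p set"
  crossings :: "'p crossing set"
  arcs :: "('p \<times> 'p) set"

text \<open>
  The A-smoothing joins the two regions swept out by rotating the overstrand counterclockwise:
  the top and bottom regions of a rising crossing, the left and right ones otherwise.
\<close>

definition A_smoothing :: "'p crossing \<Rightarrow> ('p \<times> 'p) set" where
  "A_smoothing c =
     (if rising c then {(sw c, nw c), (se c, ne c)} else {(sw c, se c), (nw c, ne c)})"

definition B_smoothing :: "'p crossing \<Rightarrow> ('p \<times> 'p) set" where
  "B_smoothing c =
     (if rising c then {(sw c, se c), (nw c, ne c)} else {(sw c, nw c), (se c, ne c)})"

text \<open>A state is given by the set of crossings that receive the A-smoothing.\<close>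

definition state_arcs :: "'p diagram \<Rightarrow> 'p crossing set \<Rightarrow> ('p \<times> 'p) set" where
  "state_arcs D s =
     arcs D \<union> (\<Union>c\<in>s. A_smoothing c) \<union> (\<Union>c\<in>crossings D - s. B_smoothing c)"

definition loops :: "'p diagram \<Rightarrow> 'p crossing set \<Rightarrow> nat" where
  "loops D s = card (points D // (state_arcs D s \<union> (state_arcs D s)\<inverse>)\<^sup>*)"


section \<open>The Kauffman bracket and the Jones polynomial\<close>

definition A_pow :: "int \<Rightarrow> laurent" where
  "A_pow k = t_pow (- of_int k / 4)"

definition delta :: laurent where
  "delta = - A_pow 2 - A_pow (- 2)"

text \<open>
  The exponent of \<^const>\<open>delta\<close> is the full number of loops (not that number minus one), so the
  bracket of a crossingless circle is \<open>delta = - t^(-1/2) - t^(1/2)\<close>.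
\<close>

definition bracket :: "'p diagram \<Rightarrow> laurent" where
  "bracket D = (\<Sum>s\<in>Pow (crossings D).
     A_pow (int (card s) - int (card (crossings D - s))) * delta ^ loops D s)"

text \<open>
  An orientation tells for each marked point whether the strand through it runs upwards.  The
  vertical direction is kept along the strands of a crossing and reversed along a maximum or minimum.
\<close>

definition orientation :: "'p diagram \<Rightarrow> ('p \<Rightarrow> bool) \<Rightarrow> bool" where
  "orientation D up \<longleftrightarrow>
     (\<forall>c\<in>crossings D. up (sw c) = up (ne c) \<and> up (se c) = up (nw c)) \<and>
     (\<forall>(p, q)\<in>arcs D. up p \<noteq> up q)"

text \<open>
  A rising crossing whose two strands both run upwards is positive; reversing one strand or
  exchanging over- and understrand changes the sign.
\<close>

definition crossing_sign :: "('p \<Rightarrow> bool) \<Rightarrow> 'p crossing \<Rightarrow> int" where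
  "crossing_sign up c = (if (up (sw c) = up (se c)) = rising c then 1 else - 1)"

definition writhe :: "'p diagram \<Rightarrow> ('p \<Rightarrow> bool) \<Rightarrow> int" where
  "writhe D up = (\<Sum>c\<in>crossings D. crossing_sign up c)"

text \<open>
  The Jones polynomial of the link presented by an oriented diagram: the bracket multiplied by
  \<open>(- A^3)^(- writhe)\<close>, where \<open>A = t^(-1/4)\<close>.
\<close>

definition jones :: "'p diagram \<Rightarrow> ('p \<Rightarrow> bool) \<Rightarrow> laurent" where
  "jones D up =
     (if even (writhe D up) then 1 else - 1) * A_pow (- 3 * writhe D up) * bracket D"


section \<open>Pretzel diagrams\<close>

text \<open>
  The point \<open>(i, k, d)\<close> lies on side \<open>d\<close> of column \<open>i\<close> at height \<open>k\<close>; the columns are numbered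
  from 0, and crossing number \<open>k\<close> of a column sits between the heights \<open>k\<close> and \<open>k + 1\<close>.
  In a column without crossings the top and bottom ends of each strand are the same marked point.
  The successor modulo the number of columns accounts for the two outer arcs.
\<close>

datatype side = Left | Right

type_synonym pretzel_point = "nat \<times> nat \<times> side"

definition column_height :: "int list \<Rightarrow> nat \<Rightarrow> nat" where
  "column_height a i = nat \<bar>a ! i\<bar>"

definition pretzel :: "int list \<Rightarrow> pretzel_point diagram" where
  "pretzel a = \<lparr>
     points = {(i, k, d) | i k d. i < length a \<and> k \<le> column_height a i},
     crossings =
       {Crossing (i, k, Left) (i, k, Right) (i, Suc k, Left) (i, Suc k, Right) (a ! i > 0) | i k.
         i < length a \<and> k < column_height a i},
     arcs = (\<Union>i\<in>{..<length a}. let j = Suc i mod length a in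
       {((i, column_height a i, Right), (j, column_height a j, Left)),
        ((i, 0, Right), (j, 0, Left))}) \<rparr>"

definition num_r :: "int list \<Rightarrow> int" where
  "num_r a = int (length (filter (\<lambda>x. x > 1) a))"

definition num_s :: "int list \<Rightarrow> int" where
  "num_s a = int (length (filter (\<lambda>x. x < - 1) a))"

definition num_z :: "int list \<Rightarrow> int" where
  "num_z a = int (count_list a 0)"

definition num_alpha :: "int list \<Rightarrow> int" where
  "num_alpha a = int (count_list a 1)"

definition num_beta :: "int list \<Rightarrow> int" where
  "num_beta a = int (count_list a (- 1))"

definition num_lambda :: "int list \<Rightarrow> int" where
  "num_lambda a = num_alpha a - num_beta a"

definition num_Sigma :: "int list \<Rightarrow> int" where
  "num_Sigma a = (\<Sum>x\<leftarrow>filter (\<lambda>x. \<bar>x\<bar> > 1) a. \<bar>x\<bar>)"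

definition reduced :: "int list \<Rightarrow> bool" where
  "reduced a \<longleftrightarrow> a = [1, - 1] \<or>
     num_alpha a * num_beta a = 0 \<and> (num_z a \<noteq> 0 \<longrightarrow> num_alpha a = 0 \<and> num_beta a = 0)"

text \<open>The 1-based entries \<open>a\<^sub>1, a\<^sub>2, ...\<close> of a pretzel diagram.\<close>

abbreviation entry :: "int list \<Rightarrow> nat \<Rightarrow> int" where
  "entry a i \<equiv> a ! (i - 1)"

end

theory Submission
  imports Defs "HOL-Library.FuncSet" "HOL-Computational_Algebra.Polynomial"
begin

text \<open>
Put \<open>y = - t\<close>, \<open>W = delta^2 - 1 = 1 - y - 1/y\<close> and \<open>U = 1 - y + y^2\<close>.  A state of a pretzel diagram selects in each
column the crossings that are smoothed horizontally.  If \<open>m > 0\<close> crossings of a column are selected, they cut off \<open>m - 1\<close>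
closed loops and block the column; if none is selected, the column stays open.  The remaining arcs form one loop per open
column, or two loops (above and below) if every column is blocked.  So the weight of a state is a product over the
columns, except for an additional factor \<open>delta^2\<close> when all columns are blocked, and the state sum of \<open>P(a_1, ..., a_n)\<close>
collapses (lemma \<open>bracket_pretzel\<close>): up to a power of \<open>t\<close>,
\<open>delta^n * bracket = (\<Prod>i. y^a_i + W) + W * (\<Prod>i. y^a_i - 1)\<close>.
Because spans are additive and \<open>delta\<close> has span 1, the span of the Jones polynomial is the span of the right-hand side
minus \<open>n\<close>.  The right-hand side is symmetric in the entries, and mirroring the diagram replaces \<open>y\<close> by \<open>1/y\<close>; so only
lowest exponents have to be found, those for \<open>a\<close> and for \<open>- a\<close> (lemmas \<open>span_from_lowest_terms\<close> and
\<open>span_symmetric\<close>).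

After clearing denominators the two products start, if no entry is zero, with \<open>y^(1 + \<beta>)\<close> and \<open>- y^(r + \<alpha>)\<close>.
For \<open>r + \<lambda> \<noteq> 1\<close> they do not interfere, which gives the general formula (\<open>lowest_cleared_generic\<close>); a zero entry
kills the second product.  For \<open>r + \<lambda> = 1\<close> the lowest terms cancel.  If \<open>r \<ge> 2\<close>, the next coefficient is
nonzero (\<open>lowest_cleared_several_positive\<close>).  If \<open>r \<le> 1\<close>, a reduced diagram has a single positive entry \<open>x\<close> (this
treats \<open>a_1 = 1\<close> and \<open>a_1 > 1\<close> alike), the other entries are \<open>- b_1 \<ge> - b_2 \<ge> ...\<close> with \<open>b_j \<ge> 2\<close>, and what is
left is \<open>y\<close> times
\<open>defect x bs = (U - y^(x+1)) * (\<Prod>j. 1 - U y^(b_j - 1)) - U * (1 - y^x) * (\<Prod>j. 1 - y^b_j)\<close>.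
The part of this linear in the \<open>y^x\<close> and \<open>y^b_j\<close> is \<open>(1 - y)^2 * (y^x - U * (\<Sum>j. y^(b_j - 1)))\<close>.  Its lowest term can
cancel only if \<open>b_1 = x + 1\<close>, then again only if \<open>b_2 = x + 2\<close>, and these two entries leave \<open>- y^(x+3)\<close> behind.  This term
meets the quadratic term \<open>y^(b_1 + b_2 - 2) = y^(2x+1)\<close>, which is too high for \<open>x \<ge> 3\<close>, cancels it for \<open>x = 2\<close>, and is
lower for \<open>x = 1\<close>, where a single further entry 4 causes one more cancellation.  Appending entries \<open>\<ge> n\<close> changes \<open>defect\<close> only from \<open>y^(n-1)\<close> on
(\<open>defect_append\<close>), so it suffices to compute \<open>defect\<close> for the lists \<open>[]\<close>, \<open>[x+1]\<close>, \<open>[x+1, x+2]\<close> and, for \<open>x = 1\<close>,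
\<open>[2, 3, 4]\<close>.  The resulting table of orders is \<open>defect_order\<close>; the exceptional pretzel links come from its
lines for \<open>x = 1\<close> and \<open>x = 2\<close>.
\<close>

section \<open>The loops of a smoothed pretzel diagram\<close>

text \<open>This reduces counting components to finding a labelling whose fibres are the components.\<close>

lemma card_quotient_by_label:
  assumes closed: "\<And>x y. (x, y) \<in> E \<Longrightarrow> x \<in> V \<and> y \<in> V \<and> f x = f y"
    and connected: "\<And>x y. x \<in> V \<Longrightarrow> y \<in> V \<Longrightarrow> f x = f y \<Longrightarrow> (x, y) \<in> (E \<union> E\<inverse>)\<^sup>*"
  shows "card (V // (E \<union> E\<inverse>)\<^sup>*) = card (f ` V)"
proof -
  have *: "y \<in> V \<and> f x = f y" if "(x, y) \<in> (E \<union> E\<inverse>)\<^sup>*" "x \<in> V" for x y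
    using that
  proof (induction rule: rtrancl_induct)
    case (step v w)
    then show ?case using closed[of v w] closed[of w v] by auto
  qed simp
  have cls: "(E \<union> E\<inverse>)\<^sup>* `` {x} = {y \<in> V. f y = f x}" if "x \<in> V" for x
  proof (rule set_eqI)
    fix z
    have "(x, z) \<in> (E \<union> E\<inverse>)\<^sup>* \<longleftrightarrow> z \<in> V \<and> f x = f z"
      using *[OF _ that] connected[OF that] by blast
    then show "z \<in> (E \<union> E\<inverse>)\<^sup>* `` {x} \<longleftrightarrow> z \<in> {y \<in> V. f y = f x}"
      by (simp add: eq_commute)
  qed
  have "V // (E \<union> E\<inverse>)\<^sup>* = (\<lambda>v. {y \<in> V. f y = v}) ` f ` V"
    by (auto simp: quotient_def cls image_iff)
  moreover have "inj_on (\<lambda>v. {y \<in> V. f y = v}) (f ` V)"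
    by (rule inj_onI) blast
  ultimately show ?thesis by (simp add: card_image)
qed

text \<open>The arcs of a column with \<open>h\<close> crossings after smoothing, where \<open>H\<close> is the set of crossings smoothed horizontally.\<close>

definition ladder_arcs :: "nat \<Rightarrow> nat \<Rightarrow> nat set \<Rightarrow> (pretzel_point \<times> pretzel_point) set" where
  "ladder_arcs i h H =
     (\<Union>k\<in>{..<h}. if k \<in> H then {((i, k, Left), (i, k, Right)), ((i, Suc k, Left), (i, Suc k, Right))}
       else {((i, k, Left), (i, Suc k, Left)), ((i, k, Right), (i, Suc k, Right))})"

definition smoothed_arcs :: "nat \<Rightarrow> (nat \<Rightarrow> nat) \<Rightarrow> (nat \<Rightarrow> nat set) \<Rightarrow> (pretzel_point \<times> pretzel_point) set" where
  "smoothed_arcs n h H = (\<Union>i<n. ladder_arcs i (h i) (H i)) \<union>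
     (\<Union>i<n. {((i, h i, Right), (Suc i mod n, h (Suc i mod n), Left)),
             ((i, 0, Right), (Suc i mod n, 0, Left))})"

definition grid :: "nat \<Rightarrow> (nat \<Rightarrow> nat) \<Rightarrow> pretzel_point set" where
  "grid n h = {(i, k, d). i < n \<and> k \<le> h i}"

text \<open>Which smoothings are horizontal is all that matters for the loops, not the signs of the crossings; so the loops are counted
for an arbitrary choice of sets \<open>H i\<close>.\<close>

locale smoothed_pretzel =
  fixes n :: nat and h :: "nat \<Rightarrow> nat" and H :: "nat \<Rightarrow> nat set"
  assumes n: "0 < n" and H: "\<And>i. i < n \<Longrightarrow> H i \<subseteq> {..<h i}"
begin

definition left_neighbour :: "nat \<Rightarrow> nat" where "left_neighbour i = (if i = 0 then n - 1 else i - 1)"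

lemma left_neighbour_mod: "i < n \<Longrightarrow> left_neighbour i < n" "i < n \<Longrightarrow> Suc (left_neighbour i) mod n = i" "i < n \<Longrightarrow> left_neighbour (Suc i mod n) = i"
proof -
  assume i: "i < n"
  show "left_neighbour i < n" "Suc (left_neighbour i) mod n = i" using i by (auto simp: left_neighbour_def)
  show "left_neighbour (Suc i mod n) = i"
    using i by (cases "Suc i = n") (auto simp: left_neighbour_def)
qed

text \<open>The bottom and the top of the diagram are treated at once: \<open>e\<close> gives the heights of the outer arcs.\<close>

definition ends :: "(nat \<Rightarrow> nat) \<Rightarrow> bool" where
  "ends e \<longleftrightarrow> e = (\<lambda>_. 0) \<or> e = h"

lemma ends_le: "ends e \<Longrightarrow> e i \<le> h i" by (auto simp: ends_def)

lemma horizontal_arc: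
  assumes "i < n" "k \<in> H i" "m = k \<or> m = Suc k"
  shows "((i, m, Left), (i, m, Right)) \<in> smoothed_arcs n h H"
proof -
  have "k < h i" using assms H by blast
  then have "((i, m, Left), (i, m, Right)) \<in> ladder_arcs i (h i) (H i)"
    unfolding ladder_arcs_def by (rule UN_I[of k, OF lessThan_iff[THEN iffD2]]) (use assms in auto)
  then show ?thesis unfolding smoothed_arcs_def using assms(1) by blast
qed

lemma vertical_arc:
  assumes "i < n" "k < h i" "k \<notin> H i"
  shows "((i, k, d), (i, Suc k, d)) \<in> smoothed_arcs n h H"
proof -
  have "((i, k, d), (i, Suc k, d)) \<in> ladder_arcs i (h i) (H i)"
    unfolding ladder_arcs_def
    by (rule UN_I[of k, OF lessThan_iff[THEN iffD2]]) (use assms in \<open>cases d; simp\<close>)+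
  then show ?thesis unfolding smoothed_arcs_def using assms(1) by blast
qed

lemma smoothed_arcs_cases:
  assumes "(p, q) \<in> smoothed_arcs n h H"
  obtains (horizontal) i k m where "i < n" "k < h i" "k \<in> H i" "m = k \<or> m = Suc k"
      "p = (i, m, Left)" "q = (i, m, Right)"
  | (vertical) i k d where "i < n" "k < h i" "k \<notin> H i" "p = (i, k, d)" "q = (i, Suc k, d)"
  | (outer) i e where "i < n" "ends e" "p = (i, e i, Right)" "q = (Suc i mod n, e (Suc i mod n), Left)"
  using assms unfolding smoothed_arcs_def
proof (elim UnE UN_E)
  fix i assume i: "i \<in> {..<n}" and "(p, q) \<in> ladder_arcs i (h i) (H i)"
  then obtain k where k: "k < h i"
    "(p, q) \<in> (if k \<in> H i then {((i, k, Left), (i, k, Right)), ((i, Suc k, Left), (i, Suc k, Right))}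
       else {((i, k, Left), (i, Suc k, Left)), ((i, k, Right), (i, Suc k, Right))})"
    unfolding ladder_arcs_def by blast
  show thesis
  proof (cases "k \<in> H i")
    case True
    then have "p = (i, k, Left) \<and> q = (i, k, Right) \<or> p = (i, Suc k, Left) \<and> q = (i, Suc k, Right)"
      using k(2) by simp
    then show thesis using horizontal[of i k] True i k(1) by blast
  next
    case False
    then have "p = (i, k, Left) \<and> q = (i, Suc k, Left) \<or> p = (i, k, Right) \<and> q = (i, Suc k, Right)"
      using k(2) by simp
    then show thesis using vertical[of i k] False i k(1) by blast
  qed
next
  fix i assume i: "i \<in> {..<n}" "(p, q) \<in> {((i, h i, Right), (Suc i mod n, h (Suc i mod n), Left)),
             ((i, 0, Right), (Suc i mod n, 0, Left))}"
  then have "p = (i, h i, Right) \<and> q = (Suc i mod n, h (Suc i mod n), Left) \<or>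
      p = (i, 0, Right) \<and> q = (Suc i mod n, 0, Left)" by simp
  then show thesis using outer[of i h] outer[of i "\<lambda>_. 0"] i(1) unfolding ends_def by blast
qed

definition conn :: "pretzel_point \<Rightarrow> pretzel_point \<Rightarrow> bool" (infix \<open>\<approx>\<close> 50) where
  "p \<approx> q \<longleftrightarrow> (p, q) \<in> (smoothed_arcs n h H \<union> (smoothed_arcs n h H)\<inverse>)\<^sup>*"

lemma conn_refl [simp]: "p \<approx> p" by (simp add: conn_def)

lemma conn_sym: "p \<approx> q \<Longrightarrow> q \<approx> p"
  unfolding conn_def by (rule symD[OF sym_rtrancl]) (auto simp: sym_def)

lemma conn_trans [trans]: "p \<approx> q \<Longrightarrow> q \<approx> r \<Longrightarrow> p \<approx> r"
  by (simp add: conn_def)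

lemma conn_arc: "(p, q) \<in> smoothed_arcs n h H \<Longrightarrow> p \<approx> q"
  by (auto simp: conn_def)

lemma finite_H: "i < n \<Longrightarrow> finite (H i)"
  using H finite_subset by blast

lemma conn_horizontal:
  assumes "i < n" "k \<in> H i"
  shows "(i, k, Left) \<approx> (i, k, Right)" "(i, Suc k, Left) \<approx> (i, Suc k, Right)"
  using horizontal_arc[OF assms] by (auto intro: conn_arc)

lemma conn_vertical_step:
  assumes "i < n" "k < h i" "k \<notin> H i"
  shows "(i, k, d) \<approx> (i, Suc k, d)"
  using assms by (intro conn_arc vertical_arc)

lemma conn_vertical:
  assumes "i < n" "k \<le> k'" "k' \<le> h i" "H i \<inter> {k..<k'} = {}"
  shows "(i, k, d) \<approx> (i, k', d)"
  using assms(2-)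
proof (induction k' rule: dec_induct)
  case (step m)
  have "H i \<inter> {k..<m} \<subseteq> H i \<inter> {k..<Suc m}" by auto
  then have "(i, k, d) \<approx> (i, m, d)" using step by simp
  also have "(i, m, d) \<approx> (i, Suc m, d)"
    using step assms(1) by (intro conn_vertical_step) auto
  finally show ?case .
qed simp

text \<open>A horizontal smoothing joins the two sides of the column just below and just above it; from there the vertical pieces carry the
connection to all other heights.\<close>

lemma conn_sides:
  assumes "i < n" "H i \<noteq> {}" "k \<le> h i"
  shows "(i, k, Left) \<approx> (i, k, Right)"
proof -
  obtain m where m: "m \<in> H i" using assms by blast
  then have mh: "m < h i" using H assms(1) by blast
  show ?thesis
  proof (cases "k \<le> m")
    case True
    then show ?thesis
    proof (induction k rule: inc_induct)
      case base
      show ?case using conn_horizontal m assms by blast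
    next
      case (step k)
      show ?case
      proof (cases "k \<in> H i")
        case False
        have v: "(i, k, d) \<approx> (i, Suc k, d)" for d
          using step False mh assms(1) by (intro conn_vertical_step) auto
        show ?thesis using v step.IH conn_sym conn_trans by blast
      qed (use conn_horizontal assms in blast)
    qed
  next
    case False
    then have "Suc m \<le> k" by simp
    then show ?thesis using assms(3)
    proof (induction k rule: dec_induct)
      case base
      show ?case using conn_horizontal m assms by blast
    next
      case (step k)
      show ?case
      proof (cases "k \<in> H i")
        case False
        have v: "(i, k, d) \<approx> (i, Suc k, d)" for d
          using step False assms(1) by (intro conn_vertical_step) auto
        show ?thesis using v step conn_sym conn_trans by (meson Suc_leD)
      qed (use conn_horizontal assms in blast)
    qed
  qed
qed

text \<open>The horizontal smoothings cut a column into pieces, and \<open>level\<close> numbers them from the bottom.  Level 0 reaches the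
bottom ends, the last level reaches the top ends, and every level in between is a closed loop.\<close>

definition level :: "nat \<Rightarrow> nat \<Rightarrow> nat" where
  "level i k = card (H i \<inter> {..<k})"

lemma level_0 [simp]: "level i 0 = 0" by (simp add: level_def)

lemma level_top [simp]: "i < n \<Longrightarrow> level i (h i) = card (H i)"
  using H[of i] by (simp add: level_def Int_absorb2)

lemma level_Suc: "i < n \<Longrightarrow> level i (Suc k) = (if k \<in> H i then Suc (level i k) else level i k)"
  unfolding level_def lessThan_Suc using finite_H by (auto simp: Int_insert_right)

lemma level_le: "i < n \<Longrightarrow> level i k \<le> card (H i)"
  unfolding level_def using finite_H by (auto intro: card_mono)

lemma level_eqD:
  assumes "i < n" "level i k = level i k'" "k \<le> k'"
  shows "H i \<inter> {k..<k'} = {}"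
proof -
  have "H i \<inter> {..<k} = H i \<inter> {..<k'}"
    using assms finite_H by (intro card_subset_eq) (auto simp: level_def)
  then have "x < k" if "x \<in> H i" "x < k'" for x
    using that by (metis IntE IntI lessThan_iff)
  then show ?thesis by fastforce
qed

lemma level_surj: "i < n \<Longrightarrow> c \<le> card (H i) \<Longrightarrow> \<exists>k\<le>h i. level i k = c"
proof -
  assume i: "i < n" and c: "c \<le> card (H i)"
  have "c \<le> level i k \<Longrightarrow> \<exists>k'\<le>k. level i k' = c" for k
  proof (induction k)
    case (Suc k)
    show ?case
    proof (cases "c \<le> level i k")
      case False
      then have "c = level i (Suc k)" using Suc.prems by (simp add: level_Suc[OF i] split: if_splits)
      then show ?thesis by blast
    qed (use Suc.IH le_Suc_eq in blast)
  qed auto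
  from this[of "h i"] show ?thesis using i c by simp
qed

lemma conn_level:
  assumes "i < n" "k \<le> h i" "k' \<le> h i" "level i k = level i k'"
  shows "(i, k, d) \<approx> (i, k', d)"
proof (cases "k \<le> k'")
  case True
  then show ?thesis using assms by (intro conn_vertical level_eqD)
next
  case False
  then show ?thesis using assms by (intro conn_sym[OF conn_vertical] level_eqD) auto
qed

lemma conn_outer: "ends e \<Longrightarrow> i < n \<Longrightarrow> (left_neighbour i, e (left_neighbour i), Right) \<approx> (i, e i, Left)"
proof (rule conn_arc)
  assume "ends e" "i < n"
  moreover have "((m, h m, Right), (Suc m mod n, h (Suc m mod n), Left)) \<in> smoothed_arcs n h H"
    "((m, 0, Right), (Suc m mod n, 0, Left)) \<in> smoothed_arcs n h H" if "m < n" for m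
    unfolding smoothed_arcs_def using that by blast+
  ultimately show "((left_neighbour i, e (left_neighbour i), Right), (i, e i, Left)) \<in> smoothed_arcs n h H"
    unfolding ends_def using left_neighbour_mod(1,2)[of i] by metis
qed

text \<open>A blocked column connects the two regions next to it, at the bottom and, separately, at the top.\<close>

lemma conn_gap:
  assumes "ends e" "i < n" "H i \<noteq> {}"
  shows "(left_neighbour i, e (left_neighbour i), Right) \<approx> (i, e i, Right)"
  using conn_trans[OF conn_outer[OF assms(1,2)] conn_sides[OF assms(2,3) ends_le[OF assms(1)]]] .

lemma conn_chain:
  assumes "ends e" "i \<le> j" "j < n" "\<And>m. i < m \<Longrightarrow> m \<le> j \<Longrightarrow> H m \<noteq> {}"
  shows "(i, e i, Right) \<approx> (j, e j, Right)"
  using assms(2-)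
proof (induction j rule: dec_induct)
  case (step m)
  have "(i, e i, Right) \<approx> (m, e m, Right)" using step by auto
  also have "(m, e m, Right) \<approx> (Suc m, e (Suc m), Right)"
    using conn_gap[of e "Suc m"] step assms(1) by (simp add: left_neighbour_def)
  finally show ?case .
qed simp

lemma card_middle:
  "card (\<Union>i<n. (\<lambda>c. (2::nat, i, c)) ` {1..<card (H i)}) = (\<Sum>i<n. card (H i) - 1)"
proof -
  have "card (\<Union>i<n. (\<lambda>c. (2::nat, i, c)) ` {1..<card (H i)})
      = (\<Sum>i<n. card ((\<lambda>c. (2::nat, i, c)) ` {1..<card (H i)}))"
    by (rule card_UN_disjoint) auto
  then show ?thesis by (simp add: card_image inj_on_def)
qed

lemma grid_arcs: "(p, q) \<in> smoothed_arcs n h H \<Longrightarrow> p \<in> grid n h \<and> q \<in> grid n h"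
proof -
  assume "(p, q) \<in> smoothed_arcs n h H"
  then show ?thesis
  proof (cases rule: smoothed_arcs_cases)
    case (outer i e)
    then show ?thesis using n ends_le[of e] by (simp add: grid_def)
  qed (auto simp: grid_def)
qed

text \<open>If every column is blocked, the bottom pieces form one loop (label \<open>(0, 0, 0)\<close>) and the top pieces another one (label
\<open>(1, 0, 0)\<close>).  A loop inside column \<open>i\<close> is labelled by \<open>i\<close> and its level; the \<open>2\<close> in front keeps the kinds apart.\<close>

definition label_all_blocked :: "pretzel_point \<Rightarrow> nat \<times> nat \<times> nat" where
  "label_all_blocked = (\<lambda>(i, k, d). if level i k = 0 then (0, 0, 0)
     else if level i k = card (H i) then (1, 0, 0) else (2, i, level i k))"

lemma components_all_blocked:
  assumes all: "\<And>i. i < n \<Longrightarrow> H i \<noteq> {}"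
  shows "card (grid n h // (smoothed_arcs n h H \<union> (smoothed_arcs n h H)\<inverse>)\<^sup>*)
    = (\<Sum>i<n. card (H i) - 1) + 2"
proof -
  have pos: "card (H i) > 0" if "i < n" for i
    using all[OF that] finite_H[OF that] by (simp add: card_gt_0_iff)
  have bot: "p \<approx> (0, 0, Right)" if lab: "p \<in> grid n h" "label_all_blocked p = (0, 0, 0)" for p
  proof -
    obtain i k d where p: "p = (i, k, d)" "i < n" "k \<le> h i" "level i k = 0"
      using lab by (cases p) (auto simp: label_all_blocked_def grid_def split: if_splits)
    have "(i, k, d) \<approx> (i, 0, d)" using p by (intro conn_level) auto
    also have "(i, 0, d) \<approx> (i, 0, Right)"
      using conn_sides[OF p(2) all[OF p(2)], of 0] by (cases d) auto
    also have "(i, 0, Right) \<approx> (0, 0, Right)"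
      using conn_sym[OF conn_chain[of "\<lambda>_. 0" 0 i]] p(2) all by (simp add: ends_def)
    finally show ?thesis using p by simp
  qed
  have top: "p \<approx> (0, h 0, Right)" if lab: "p \<in> grid n h" "label_all_blocked p = (1, 0, 0)" for p
  proof -
    obtain i k d where p: "p = (i, k, d)" "i < n" "k \<le> h i" "level i k = card (H i)"
      using lab by (cases p) (auto simp: label_all_blocked_def grid_def split: if_splits)
    have "(i, k, d) \<approx> (i, h i, d)" using p by (intro conn_level) auto
    also have "(i, h i, d) \<approx> (i, h i, Right)"
      using conn_sides[OF p(2) all[OF p(2)], of "h i"] by (cases d) auto
    also have "(i, h i, Right) \<approx> (0, h 0, Right)"
      using conn_sym[OF conn_chain[of h 0 i]] p(2) all by (simp add: ends_def)
    finally show ?thesis using p by simp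
  qed
  have "card (grid n h // (smoothed_arcs n h H \<union> (smoothed_arcs n h H)\<inverse>)\<^sup>*) = card (label_all_blocked ` grid n h)"
  proof (rule card_quotient_by_label)
    fix p q assume *: "(p, q) \<in> smoothed_arcs n h H"
    have "label_all_blocked p = label_all_blocked q"
      using *
    proof (cases rule: smoothed_arcs_cases)
      case (outer i e)
      then show ?thesis using n pos[of i] pos[of "Suc i mod n"] by (auto simp: label_all_blocked_def ends_def)
    qed (simp_all add: label_all_blocked_def level_Suc)
    then show "p \<in> grid n h \<and> q \<in> grid n h \<and> label_all_blocked p = label_all_blocked q" using grid_arcs * by blast
  next
    fix p q assume *: "p \<in> grid n h" "q \<in> grid n h" "label_all_blocked p = label_all_blocked q"
    obtain i k d where p: "p = (i, k, d)" "i < n" "k \<le> h i" using * by (auto simp: grid_def)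
    obtain i' k' d' where q: "q = (i', k', d')" "i' < n" "k' \<le> h i'" using * by (auto simp: grid_def)
    consider "label_all_blocked p = (0, 0, 0)" | "label_all_blocked p = (1, 0, 0)" | "i = i'" "level i k = level i k'"
      using *(3) p q by (auto simp: label_all_blocked_def split: if_splits)
    then have "p \<approx> q"
    proof cases
      case 3
      have "(i, k, d) \<approx> (i, k', d)" using 3 p q by (intro conn_level) auto
      also have "(i, k', d) \<approx> (i, k', d')"
        using conn_sides[OF p(2) all[OF p(2)], of k'] conn_sym 3 q by (cases d; cases d') auto
      finally show ?thesis using 3 p q by simp
    next
      case 1
      then show ?thesis using bot[of p] bot[of q] * by (auto intro: conn_trans conn_sym)
    next
      case 2
      then show ?thesis using top[of p] top[of q] * by (auto intro: conn_trans conn_sym)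
    qed
    then show "(p, q) \<in> (smoothed_arcs n h H \<union> (smoothed_arcs n h H)\<inverse>)\<^sup>*"
      by (simp add: conn_def)
  qed
  also have "label_all_blocked ` grid n h =
      (\<Union>i<n. (\<lambda>c. (2, i, c)) ` {1..<card (H i)}) \<union> {(0, 0, 0), (1, 0, 0)}" (is "_ = ?M \<union> _")
  proof (intro equalityI subsetI)
    fix x assume "x \<in> label_all_blocked ` grid n h"
    then obtain i k d where "x = label_all_blocked (i, k, d)" "i < n" by (auto simp: grid_def)
    then show "x \<in> ?M \<union> {(0, 0, 0), (1, 0, 0)}"
      using level_le[of i k] by (auto simp: label_all_blocked_def image_iff)
  next
    fix x assume "x \<in> ?M \<union> {(0, 0, 0), (1, 0, 0)}"
    then consider "x = (0, 0, 0)" | "x = (1, 0, 0)" | i c where "x = (2, i, c)" "i < n" "1 \<le> c" "c < card (H i)"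
      by auto
    then show "x \<in> label_all_blocked ` grid n h"
    proof cases
      case 1
      then show ?thesis using n by (intro image_eqI[of _ _ "(0, 0, Left)"]) (auto simp: label_all_blocked_def grid_def)
    next
      case 2
      then show ?thesis using n pos[of 0] by (intro image_eqI[of _ _ "(0, h 0, Left)"]) (auto simp: label_all_blocked_def grid_def)
    next
      case 3
      then obtain k where "k \<le> h i" "level i k = c" using level_surj[of i c] by auto
      then show ?thesis using 3 by (intro image_eqI[of _ _ "(i, k, Left)"]) (auto simp: label_all_blocked_def grid_def)
    qed
  qed
  also have "card \<dots> = card ?M + card {(0::nat, 0::nat, 0::nat), (1, 0, 0)}"
    by (intro card_Un_disjoint) auto
  finally show ?thesis unfolding card_middle by simp
qed

text \<open>Now suppose that some column is open.  Its two strands connect top and bottom.  The right strand of an open column \<open>v\<close>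
passes through all blocked columns up to the next open one, so each outer loop belongs to exactly one open column.
The function \<open>wall\<close> finds, going cyclically to the left from the gap at the right of column \<open>g\<close>, the open column to which this gap
belongs.\<close>

definition open_columns :: "nat set" where "open_columns = {i. i < n \<and> H i = {}}"

definition wall :: "nat \<Rightarrow> nat" where
  "wall g = (if \<exists>i\<in>open_columns. i \<le> g then Max {i \<in> open_columns. i \<le> g} else Max open_columns)"

definition gap :: "nat \<Rightarrow> side \<Rightarrow> nat" where
  "gap i d = (case d of Left \<Rightarrow> left_neighbour i | Right \<Rightarrow> i)"

lemma finite_open_columns: "finite open_columns" by (simp add: open_columns_def)

lemma wall_in: "open_columns \<noteq> {} \<Longrightarrow> wall g \<in> open_columns"
proof -
  assume v: "open_columns \<noteq> {}"
  show ?thesis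
  proof (cases "\<exists>i\<in>open_columns. i \<le> g")
    case True
    then have "Max {i \<in> open_columns. i \<le> g} \<in> {i \<in> open_columns. i \<le> g}"
      using finite_open_columns by (intro Max_in) auto
    then show ?thesis using True by (simp add: wall_def)
  qed (use v finite_open_columns in \<open>simp add: wall_def\<close>)
qed

lemma wall_self: "i \<in> open_columns \<Longrightarrow> wall i = i"
proof -
  assume i: "i \<in> open_columns"
  then have "Max {j \<in> open_columns. j \<le> i} = i"
    using finite_open_columns by (intro Max_eqI) auto
  then show ?thesis unfolding wall_def using i by auto
qed

lemma wall_left_neighbour:
  assumes "i < n" "H i \<noteq> {}"
  shows "wall (left_neighbour i) = wall i"
proof (cases "i = 0")
  case True
  have "{j \<in> open_columns. j \<le> n - 1} = open_columns" using n by (auto simp: open_columns_def)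
  moreover have "\<not> (\<exists>j\<in>open_columns. j \<le> 0)" using assms True by (auto simp: open_columns_def)
  ultimately show ?thesis using True by (auto simp: wall_def left_neighbour_def)
next
  case False
  have "j \<le> i - 1 \<longleftrightarrow> j \<le> i" if "j \<in> open_columns" for j
    using that assms False by (cases "j = i") (auto simp: open_columns_def)
  then have "{j \<in> open_columns. j \<le> i - 1} = {j \<in> open_columns. j \<le> i}" "(\<exists>j\<in>open_columns. j \<le> i - 1) \<longleftrightarrow> (\<exists>j\<in>open_columns. j \<le> i)"
    by auto
  then show ?thesis using False by (simp add: wall_def left_neighbour_def)
qed

lemma conn_wall:
  assumes "ends e" "g < n" "open_columns \<noteq> {}"
  shows "(g, e g, Right) \<approx> (wall g, e (wall g), Right)"
proof (cases "\<exists>i\<in>open_columns. i \<le> g")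
  case True
  then have w: "wall g = Max {i \<in> open_columns. i \<le> g}" by (simp add: wall_def)
  have f: "finite {i \<in> open_columns. i \<le> g}" using finite_open_columns by simp
  have "wall g \<in> {i \<in> open_columns. i \<le> g}" unfolding w using True f by (intro Max_in) auto
  moreover have "H m \<noteq> {}" if "wall g < m" "m \<le> g" for m
    using that Max_ge[OF f, of m] assms(2) by (fastforce simp: w open_columns_def)
  ultimately show ?thesis using conn_chain[of e "wall g" g] assms conn_sym by blast
next
  case False
  then have w: "wall g = Max open_columns" by (simp add: wall_def)
  have mx: "Max open_columns \<in> open_columns" using assms finite_open_columns by simp
  have none: "H m \<noteq> {}" if "m \<le> g" for m using that False assms(2) by (auto simp: open_columns_def)
  have "(g, e g, Right) \<approx> (0, e 0, Right)"
    using conn_chain[of e 0 g] assms none conn_sym by blast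
  also have "(0, e 0, Right) \<approx> (n - 1, e (n - 1), Right)"
    using conn_gap[of e 0] assms n none[of 0] conn_sym by (simp add: left_neighbour_def)
  also have "(n - 1, e (n - 1), Right) \<approx> (wall g, e (wall g), Right)"
  proof (rule conn_sym, rule conn_chain)
    fix m assume "wall g < m" "m \<le> n - 1"
    then show "H m \<noteq> {}" using Max_ge[OF finite_open_columns, of m] n by (fastforce simp: w open_columns_def)
  qed (use assms n mx w in \<open>auto simp: open_columns_def\<close>)
  finally show ?thesis .
qed

definition label_some_open :: "pretzel_point \<Rightarrow> nat \<times> nat \<times> nat" where
  "label_some_open = (\<lambda>(i, k, d). if level i k = 0 \<or> level i k = card (H i) then (0, wall (gap i d), 0)
     else (2, i, level i k))"

lemma components_some_open:
  assumes open_columns: "open_columns \<noteq> {}"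
  shows "card (grid n h // (smoothed_arcs n h H \<union> (smoothed_arcs n h H)\<inverse>)\<^sup>*)
    = (\<Sum>i<n. card (H i) - 1) + card open_columns"
proof -
  have outer: "(i, k, d) \<approx> (wall (gap i d), 0, Right)"
    if i: "i < n" "k \<le> h i" "level i k = 0 \<or> level i k = card (H i)" for i k d
  proof -
    define e where "e = (if level i k = 0 then (\<lambda>_. 0) else h)"
    have e: "ends e" "level i k = level i (e i)"
      using i by (auto simp: e_def ends_def)
    let ?v = "wall (gap i d)"
    have "(i, k, d) \<approx> (i, e i, d)" using i e ends_le[of e i] by (intro conn_level) auto
    also have "(i, e i, d) \<approx> (gap i d, e (gap i d), Right)"
      using conn_outer[OF e(1) i(1)] conn_sym by (cases d) (auto simp: gap_def)
    also have "(gap i d, e (gap i d), Right) \<approx> (?v, e ?v, Right)"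
      using e i left_neighbour_mod(1)[of i] open_columns by (intro conn_wall) (auto simp: gap_def split: side.split)
    also have "(?v, e ?v, Right) \<approx> (?v, 0, Right)"
      using wall_in[OF open_columns, of "gap i d"] e ends_le[of e ?v] by (intro conn_level) (auto simp: open_columns_def level_def)
    finally show ?thesis .
  qed
  have "card (grid n h // (smoothed_arcs n h H \<union> (smoothed_arcs n h H)\<inverse>)\<^sup>*) = card (label_some_open ` grid n h)"
  proof (rule card_quotient_by_label)
    fix p q assume *: "(p, q) \<in> smoothed_arcs n h H"
    have sides: "label_some_open (i, k, Left) = label_some_open (i, k, Right)" if "i < n" "m \<in> H i" for i k m
      using wall_left_neighbour[of i] that by (auto simp: label_some_open_def gap_def)
    have "label_some_open p = label_some_open q"
      using *
    proof (cases rule: smoothed_arcs_cases)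
      case (horizontal i k m)
      then show ?thesis using sides by blast
    next
      case (vertical i k d)
      then show ?thesis by (auto simp: label_some_open_def level_Suc gap_def)
    next
      case (outer i e)
      then show ?thesis using n left_neighbour_mod(3)[of i] by (auto simp: label_some_open_def gap_def ends_def)
    qed
    then show "p \<in> grid n h \<and> q \<in> grid n h \<and> label_some_open p = label_some_open q" using grid_arcs * by blast
  next
    fix p q assume *: "p \<in> grid n h" "q \<in> grid n h" "label_some_open p = label_some_open q"
    obtain i k d where p: "p = (i, k, d)" "i < n" "k \<le> h i" using * by (auto simp: grid_def)
    obtain i' k' d' where q: "q = (i', k', d')" "i' < n" "k' \<le> h i'" using * by (auto simp: grid_def)
    have "p \<approx> q"
    proof (cases "level i k = 0 \<or> level i k = card (H i)")
      case True
      then have "level i' k' = 0 \<or> level i' k' = card (H i')" "wall (gap i d) = wall (gap i' d')"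
        using *(3) p q by (auto simp: label_some_open_def split: if_splits)
      then have "(i', k', d') \<approx> (wall (gap i d), 0, Right)"
        using outer[of i' k' d'] q by simp
      then show ?thesis using outer[of i k d] True p q by (blast intro: conn_trans conn_sym)
    next
      case False
      then have 3: "i = i'" "level i k = level i k'" "H i \<noteq> {}"
        using *(3) p q by (auto simp: label_some_open_def level_def split: if_splits)
      have "(i, k, d) \<approx> (i, k', d)" using 3 p q by (intro conn_level) auto
      also have "(i, k', d) \<approx> (i, k', d')"
        using conn_sides[of i k'] conn_sym 3 p q by (cases d; cases d') auto
      finally show ?thesis using 3 p q by simp
    qed
    then show "(p, q) \<in> (smoothed_arcs n h H \<union> (smoothed_arcs n h H)\<inverse>)\<^sup>*"
      by (simp add: conn_def)
  qed
  also have "label_some_open ` grid n h =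
      (\<Union>i<n. (\<lambda>c. (2, i, c)) ` {1..<card (H i)}) \<union> (\<lambda>v. (0, v, 0)) ` open_columns" (is "_ = ?M \<union> ?N")
  proof (intro equalityI subsetI)
    fix x assume "x \<in> label_some_open ` grid n h"
    then obtain i k d where "x = label_some_open (i, k, d)" "i < n" by (auto simp: grid_def)
    then show "x \<in> ?M \<union> ?N"
      using level_le[of i k] wall_in[OF open_columns] by (auto simp: label_some_open_def image_iff)
  next
    fix x assume "x \<in> ?M \<union> ?N"
    then consider v where "x = (0, v, 0)" "v \<in> open_columns" | i c where "x = (2, i, c)" "i < n" "1 \<le> c" "c < card (H i)"
      by auto
    then show "x \<in> label_some_open ` grid n h"
    proof cases
      case 1
      then show ?thesis using wall_self[of v]
        by (intro image_eqI[of _ _ "(v, 0, Right)"]) (auto simp: label_some_open_def grid_def gap_def open_columns_def)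
    next
      case 2
      then obtain k where "k \<le> h i" "level i k = c" using level_surj[of i c] by auto
      then show ?thesis using 2 by (intro image_eqI[of _ _ "(i, k, Left)"]) (auto simp: label_some_open_def grid_def)
    qed
  qed
  also have "card \<dots> = card ?M + card ?N"
    using finite_open_columns by (intro card_Un_disjoint) auto
  finally show ?thesis unfolding card_middle by (simp add: card_image inj_on_def)
qed

end

section \<open>The bracket of a pretzel diagram\<close>

text \<open>The power \<open>y^x\<close> of \<open>y = - t\<close>.\<close>

definition signed_pow :: "int \<Rightarrow> laurent" where
  "signed_pow x = (if even x then 1 else - 1) * t_pow (of_int x)"

definition W :: laurent where "W = delta ^ 2 - 1"

text \<open>The value of \<open>delta^n * bracket\<close> up to a power of \<open>t\<close>, see \<open>bracket_pretzel\<close> below.\<close>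

definition two_products :: "int list \<Rightarrow> laurent" where
  "two_products a = (\<Prod>x\<leftarrow>a. signed_pow x + W) + W * (\<Prod>x\<leftarrow>a. signed_pow x - 1)"

lemma t_pow_0: "t_pow 0 = 1" by (simp add: t_pow_def)

lemma t_pow_add: "t_pow (p + q) = t_pow p * t_pow q"
  by (simp add: t_pow_def mult_single)

lemma A_pow_0: "A_pow 0 = 1" by (simp add: A_pow_def t_pow_0)

lemma A_pow_add: "A_pow (i + j) = A_pow i * A_pow j"
  by (simp add: A_pow_def t_pow_add[symmetric] add_divide_distrib diff_divide_distrib)

lemma A_pow_sum: "A_pow (\<Sum>i\<in>I. f i) = (\<Prod>i\<in>I. A_pow (f i))"
  by (induction I rule: infinite_finite_induct) (simp_all add: A_pow_0 A_pow_add)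

lemma A_pow_power: "A_pow (int k * i) = A_pow i ^ k"
  by (induction k) (simp_all add: A_pow_0 A_pow_add algebra_simps)

definition cross :: "int list \<Rightarrow> nat \<times> nat \<Rightarrow> pretzel_point crossing" where
  "cross a = (\<lambda>(i, k). Crossing (i, k, Left) (i, k, Right) (i, Suc k, Left) (i, Suc k, Right) (a ! i > 0))"

definition rungs :: "int list \<Rightarrow> (nat \<times> nat) set" where
  "rungs a = Sigma {..<length a} (\<lambda>i. {..<column_height a i})"

lemma inj_cross: "inj_on (cross a) S"
  by (auto simp: inj_on_def cross_def)

lemma crossings_pretzel: "crossings (pretzel a) = cross a ` rungs a"
  by (auto simp: pretzel_def cross_def rungs_def image_iff)

text \<open>The horizontal smoothing of a rising crossing is its B-smoothing, that of a falling one its A-smoothing.\<close>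

definition state_of :: "int list \<Rightarrow> (nat \<Rightarrow> nat set) \<Rightarrow> pretzel_point crossing set" where
  "state_of a H = cross a ` Sigma {..<length a}
     (\<lambda>i. if a ! i > 0 then {..<column_height a i} - H i else H i)"

definition families :: "int list \<Rightarrow> (nat \<Rightarrow> nat set) set" where
  "families a = Pi\<^sub>E {..<length a} (\<lambda>i. Pow {..<column_height a i})"

lemma cross_in_state:
  "cross a (i, k) \<in> state_of a H \<longleftrightarrow> i < length a \<and> (if a ! i > 0 then k < column_height a i \<and> k \<notin> H i else k \<in> H i)"
  unfolding state_of_def inj_on_image_mem_iff[OF inj_cross, of _ UNIV, simplified] by simp

lemma state_of_subset: "H \<in> families a \<Longrightarrow> state_of a H \<subseteq> crossings (pretzel a)"
  unfolding state_of_def crossings_pretzel rungs_def families_def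
  by (intro image_mono Sigma_mono) (auto simp: PiE_iff)

text \<open>States correspond bijectively to families of sets of horizontally smoothed crossings; this turns the state sum into a
sum over a product set.\<close>

lemma sum_states:
  "(\<Sum>s\<in>Pow (crossings (pretzel a)). f s) = (\<Sum>H\<in>families a. f (state_of a H))"
proof (rule sum.reindex_bij_witness[where j = "\<lambda>s. \<lambda>i\<in>{..<length a}.
    {k. k < column_height a i \<and> (cross a (i, k) \<in> s) \<noteq> (a ! i > 0)}" and i = "state_of a"])
  fix s assume s: "s \<in> Pow (crossings (pretzel a))"
  let ?H = "\<lambda>i\<in>{..<length a}. {k. k < column_height a i \<and> (cross a (i, k) \<in> s) \<noteq> (a ! i > 0)}"
  show "?H \<in> families a" by (auto simp: families_def)
  then have sub: "state_of a ?H \<subseteq> crossings (pretzel a)" by (rule state_of_subset)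
  have mem: "cross a (i, k) \<in> state_of a ?H \<longleftrightarrow> cross a (i, k) \<in> s" if "(i, k) \<in> rungs a" for i k
    using that by (auto simp: cross_in_state rungs_def)
  show eq: "state_of a ?H = s"
  proof (intro equalityI subsetI)
    fix c assume c: "c \<in> state_of a ?H"
    then obtain i k where "(i, k) \<in> rungs a" "c = cross a (i, k)"
      using sub unfolding crossings_pretzel by force
    then show "c \<in> s" using mem c by blast
  next
    fix c assume c: "c \<in> s"
    then obtain i k where "(i, k) \<in> rungs a" "c = cross a (i, k)"
      using s unfolding crossings_pretzel by force
    then show "c \<in> state_of a ?H" using mem c by blast
  qed
  show "f (state_of a ?H) = f s" by (simp only: eq)
next
  fix H assume H: "H \<in> families a"
  show "state_of a H \<in> Pow (crossings (pretzel a))" using state_of_subset[OF H] by simp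
  show "(\<lambda>i\<in>{..<length a}. {k. k < column_height a i \<and> (cross a (i, k) \<in> state_of a H) \<noteq> (a ! i > 0)}) = H"
  proof
    fix i
    show "(\<lambda>i\<in>{..<length a}. {k. k < column_height a i \<and> (cross a (i, k) \<in> state_of a H) \<noteq> (a ! i > 0)}) i = H i"
    proof (cases "i < length a")
      case True
      then have "H i \<subseteq> {..<column_height a i}" using H by (auto simp: families_def PiE_iff)
      then show ?thesis using True by (auto simp: cross_in_state split: if_splits)
    next
      case False
      then show ?thesis using H by (auto simp: families_def PiE_iff extensional_def)
    qed
  qed
qed

lemma family_subset: "H \<in> families a \<Longrightarrow> i < length a \<Longrightarrow> H i \<subseteq> {..<column_height a i}"
  by (auto simp: families_def PiE_iff)

lemma state_exponent:
  assumes H: "H \<in> families a"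
  shows "int (card (state_of a H)) - int (card (crossings (pretzel a) - state_of a H)) =
    (\<Sum>i<length a. a ! i - 2 * sgn (a ! i) * int (card (H i)))"
proof -
  let ?n = "length a" and ?h = "column_height a"
  have fin: "finite (H i)" "card (H i) \<le> ?h i" if "i < ?n" for i
    using family_subset[OF H that] finite_subset card_mono[of "{..<?h i}"] by auto
  have "crossings (pretzel a) - state_of a H =
      cross a ` (rungs a - Sigma {..<?n} (\<lambda>i. if a ! i > 0 then {..<?h i} - H i else H i))"
    unfolding crossings_pretzel state_of_def
    by (rule inj_on_image_set_diff[OF inj_cross[where S = UNIV], symmetric]) auto
  also have "rungs a - Sigma {..<?n} (\<lambda>i. if a ! i > 0 then {..<?h i} - H i else H i) =
      Sigma {..<?n} (\<lambda>i. if a ! i > 0 then H i else {..<?h i} - H i)"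
    unfolding rungs_def using family_subset[OF H] by (fastforce split: if_splits)
  finally have "int (card (crossings (pretzel a) - state_of a H)) =
      (\<Sum>i<?n. if a ! i > 0 then int (card (H i)) else int (?h i) - int (card (H i)))"
    using fin family_subset[OF H]
    by (simp add: card_image[OF inj_cross] card_SigmaI if_distrib[of card] if_distrib[of int] card_Diff_subset of_nat_diff cong: if_cong)
  moreover have "int (card (state_of a H)) =
      (\<Sum>i<?n. if a ! i > 0 then int (?h i) - int (card (H i)) else int (card (H i)))"
    unfolding state_of_def using fin family_subset[OF H]
    by (simp add: card_image[OF inj_cross] card_SigmaI if_distrib[of card] if_distrib[of int] card_Diff_subset of_nat_diff cong: if_cong)
  ultimately have "int (card (state_of a H)) - int (card (crossings (pretzel a) - state_of a H)) =
     (\<Sum>i<?n. (if a ! i > 0 then int (?h i) - int (card (H i)) else int (card (H i)))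
        - (if a ! i > 0 then int (card (H i)) else int (?h i) - int (card (H i))))"
    by (simp add: sum_subtractf)
  also have "\<dots> = (\<Sum>i<?n. a ! i - 2 * sgn (a ! i) * int (card (H i)))"
  proof (rule sum.cong[OF refl])
    fix i assume i: "i \<in> {..<?n}"
    then have "card (H i) = 0" if "a ! i = 0" using fin[of i] that by (simp add: column_height_def)
    then show "(if a ! i > 0 then int (?h i) - int (card (H i)) else int (card (H i)))
        - (if a ! i > 0 then int (card (H i)) else int (?h i) - int (card (H i)))
        = a ! i - 2 * sgn (a ! i) * int (card (H i))"
      by (cases "a ! i" "0 :: int" rule: linorder_cases) (auto simp: column_height_def)
  qed
  finally show ?thesis .
qed

lemma state_arcs_pretzel:
  assumes H: "H \<in> families a"
  shows "state_arcs (pretzel a) (state_of a H) = smoothed_arcs (length a) (column_height a) H"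
proof -
  let ?n = "length a" and ?h = "column_height a" and ?s = "state_of a H"
  define sm where "sm = (\<lambda>(i, k). if k \<in> H i then {((i, k, Left), (i, k, Right)), ((i, Suc k, Left), (i, Suc k, Right))}
       else {((i, k, Left), (i, Suc k, Left)), ((i, k, Right), (i, Suc k, Right))})"
  have sm: "(if cross a p \<in> ?s then A_smoothing (cross a p) else B_smoothing (cross a p)) = sm p"
    if "p \<in> rungs a" for p
  proof -
    obtain i k where p: "p = (i, k)" by (cases p)
    then have "i < ?n" "k < ?h i" using that by (auto simp: rungs_def)
    then show ?thesis unfolding p cross_in_state
      by (auto simp: sm_def cross_def A_smoothing_def B_smoothing_def)
  qed
  have "(\<Union>c\<in>?s. A_smoothing c) \<union> (\<Union>c\<in>crossings (pretzel a) - ?s. B_smoothing c) =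
      (\<Union>c\<in>crossings (pretzel a). if c \<in> ?s then A_smoothing c else B_smoothing c)"
    using state_of_subset[OF H] by auto
  also have "\<dots> = (\<Union>p\<in>rungs a. if cross a p \<in> ?s then A_smoothing (cross a p) else B_smoothing (cross a p))"
    unfolding crossings_pretzel image_image ..
  also have "\<dots> = (\<Union>p\<in>rungs a. sm p)" using sm by simp
  also have "\<dots> = (\<Union>i<?n. ladder_arcs i (?h i) (H i))"
    unfolding rungs_def ladder_arcs_def sm_def by fastforce
  finally have "(\<Union>c\<in>?s. A_smoothing c) \<union> (\<Union>c\<in>crossings (pretzel a) - ?s. B_smoothing c) =
      (\<Union>i<?n. ladder_arcs i (?h i) (H i))" .
  then show ?thesis
    unfolding state_arcs_def smoothed_arcs_def Un_assoc by (simp add: pretzel_def Let_def Un_commute)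
qed

text \<open>The share of a column in the number of loops: an open column owns one outer loop, a blocked one only the loops cut
off inside it.\<close>

definition column_loops :: "nat set \<Rightarrow> nat" where
  "column_loops X = (if X = {} then 1 else card X - 1)"

text \<open>The correction 2 for the outer loops when all columns are blocked is the only interaction between the columns.\<close>

lemma loops_pretzel:
  assumes a: "a \<noteq> []" and fam: "H \<in> families a"
  shows "loops (pretzel a) (state_of a H) =
    (\<Sum>i<length a. column_loops (H i)) + (if \<forall>i<length a. H i \<noteq> {} then 2 else 0)"
proof -
  interpret smoothed_pretzel "length a" "column_height a" H
    by unfold_locales (use a family_subset[OF fam] in auto)
  have pts: "points (pretzel a) = grid (length a) (column_height a)"
    by (auto simp: pretzel_def grid_def)
  show ?thesis
  proof (cases "\<forall>i<length a. H i \<noteq> {}")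
    case True
    then show ?thesis
      unfolding loops_def state_arcs_pretzel[OF fam] pts
      by (simp add: components_all_blocked column_loops_def)
  next
    case False
    then have v: "open_columns \<noteq> {}" by (auto simp: open_columns_def)
    have "card open_columns = (\<Sum>i<length a. if H i = {} then 1 else 0)"
      by (simp add: open_columns_def sum.If_cases lessThan_def Collect_conj_eq)
    then have "(\<Sum>i<length a. card (H i) - 1) + card open_columns =
        (\<Sum>i<length a. (card (H i) - 1) + (if H i = {} then 1 else 0))"
      by (simp only: sum.distrib)
    also have "\<dots> = (\<Sum>i<length a. column_loops (H i))"
      by (rule sum.cong) (auto simp: column_loops_def)
    finally show ?thesis using False
      unfolding loops_def state_arcs_pretzel[OF fam] pts components_some_open[OF v] by simp
  qed
qed

definition column_weight :: "int \<Rightarrow> nat set \<Rightarrow> laurent" where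
  "column_weight x X = A_pow (x - 2 * sgn x * int (card X)) * delta ^ column_loops X"

lemma sum_Pow_card:
  fixes c :: "'a :: comm_ring_1"
  assumes "finite S"
  shows "(\<Sum>X\<in>Pow S. c ^ card X) = (c + 1) ^ card S"
  using prod_add[OF assms, of "\<lambda>_. c" "\<lambda>_. 1"] by simp

lemma t_pow_1_power: "(- t_pow q) ^ k = (if even k then 1 else - 1) * t_pow (of_nat k * q)"
  by (induction k) (auto simp: t_pow_0 t_pow_add algebra_simps)

text \<open>Up to a power of \<open>A\<close>, the expansion of the left-hand side is the sum over all smoothings of a column, each horizontal
one weighted with \<open>delta\<close>.  It collapses because \<open>1 + A^2 delta = - A^4\<close>, \<open>1 + A^(-2) delta = - A^(-4)\<close> and
\<open>A^(-4) = t\<close>; in other words, the bracket of a kink is \<open>- A^3\<close> or \<open>- A^(-3)\<close> times that of a plain strand.\<close>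

lemma twist_power:
  "(A_pow (- 2 * sgn x) * delta + 1) ^ nat \<bar>x\<bar> = signed_pow x"
proof (cases "x = 0")
  case True
  then show ?thesis by (simp add: signed_pow_def t_pow_0)
next
  case False
  then consider "x > 0" | "x < 0" by linarith
  then show ?thesis
  proof cases
    case 1
    have "A_pow (- 2) * delta + 1 = - A_pow (- 4)"
      by (simp add: delta_def algebra_simps A_pow_add[symmetric] A_pow_0)
    also have "A_pow (- 4) = t_pow 1" by (simp add: A_pow_def)
    finally show ?thesis using 1 by (simp add: t_pow_1_power signed_pow_def even_nat_iff)
  next
    case 2
    have "A_pow 2 * delta + 1 = - A_pow 4"
      by (simp add: delta_def algebra_simps A_pow_add[symmetric] A_pow_0)
    also have "A_pow 4 = t_pow (- 1)" by (simp add: A_pow_def)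
    finally show ?thesis using 2 by (simp add: t_pow_1_power signed_pow_def even_nat_iff)
  qed
qed

text \<open>The factor \<open>delta\<close> makes the exponent of \<open>delta\<close> equal to the number of horizontal smoothings, so that the binomial theorem
applies.\<close>

lemma column_sum_blocked:
  "delta * (\<Sum>X\<in>Pow {..<nat \<bar>x\<bar>} - {{}}. column_weight x X) = A_pow x * (signed_pow x - 1)"
proof -
  let ?c = "A_pow (- 2 * sgn x) * delta" and ?P = "Pow {..<nat \<bar>x\<bar>}"
  have "delta * column_weight x X = A_pow x * ?c ^ card X" if "X \<in> ?P - {{}}" for X
  proof -
    have "finite X" using that finite_subset[of X "{..<nat \<bar>x\<bar>}"] by auto
    then have c: "card X = Suc (card X - 1)" using that by (simp add: card_gt_0_iff)
    have "delta * column_weight x X = A_pow (x - 2 * sgn x * int (card X)) * delta ^ card X"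
      using that by (subst c) (simp add: column_weight_def column_loops_def)
    also have "A_pow (x - 2 * sgn x * int (card X)) = A_pow x * A_pow (- 2 * sgn x) ^ card X"
      by (simp add: A_pow_add[symmetric] A_pow_power[symmetric] algebra_simps)
    finally show ?thesis by (simp add: power_mult_distrib algebra_simps)
  qed
  then have "delta * (\<Sum>X\<in>?P - {{}}. column_weight x X) = A_pow x * (\<Sum>X\<in>?P - {{}}. ?c ^ card X)"
    by (simp only: sum_distrib_left cong: sum.cong)
  also have "(\<Sum>X\<in>?P - {{}}. ?c ^ card X) = (\<Sum>X\<in>?P. ?c ^ card X) - 1"
    by (subst sum_diff) auto
  also have "(\<Sum>X\<in>?P. ?c ^ card X) = signed_pow x"
    using twist_power[of x] by (simp add: sum_Pow_card)
  finally show ?thesis .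
qed

lemma column_sum:
  "delta * (\<Sum>X\<in>Pow {..<nat \<bar>x\<bar>}. column_weight x X) = A_pow x * (signed_pow x + W)"
proof -
  have "(\<Sum>X\<in>Pow {..<nat \<bar>x\<bar>}. column_weight x X) =
      column_weight x {} + (\<Sum>X\<in>Pow {..<nat \<bar>x\<bar>} - {{}}. column_weight x X)"
    by (rule sum.remove) auto
  then show ?thesis
    using column_sum_blocked[of x]
    by (simp add: W_def column_weight_def column_loops_def algebra_simps power2_eq_square)
qed

lemma prod_nth: "(\<Prod>i<length a. f (a ! i)) = (\<Prod>x\<leftarrow>a. f x)"
  by (simp add: prod.list_conv_set_nth atLeast0LessThan)

text \<open>If the weights were multiplicative, the bracket would be the product of the column sums.  The states with all columns blocked
have the extra factor \<open>delta^2\<close>, which adds \<open>W = delta^2 - 1\<close> times the product of the sums over blocking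
smoothings.\<close>

lemma bracket_pretzel:
  assumes a: "a \<noteq> []"
  shows "delta ^ length a * bracket (pretzel a) = A_pow (sum_list a) * two_products a"
proof -
  let ?n = "length a" and ?P = "\<lambda>i. Pow {..<column_height a i}"
  define g where "g H = (\<Prod>i<?n. column_weight (a ! i) (H i))" for H :: "nat \<Rightarrow> nat set"
  have summand: "A_pow (int (card (state_of a H)) - int (card (crossings (pretzel a) - state_of a H))) *
      delta ^ loops (pretzel a) (state_of a H) = g H * (if \<forall>i<?n. H i \<noteq> {} then delta ^ 2 else 1)"
    if "H \<in> families a" for H
  proof -
    have two: "delta ^ (if P then 2 else 0) = (if P then delta ^ 2 else 1)" for P
      by simp
    have "delta ^ loops (pretzel a) (state_of a H) =
        (\<Prod>i<?n. delta ^ column_loops (H i)) * (if \<forall>i<?n. H i \<noteq> {} then delta ^ 2 else 1)"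
      unfolding loops_pretzel[OF a that] power_add power_sum two ..
    then show ?thesis
      unfolding state_exponent[OF that] A_pow_sum g_def column_weight_def prod.distrib
      by (simp only: mult.assoc)
  qed
  have "bracket (pretzel a) = (\<Sum>H\<in>families a. g H * (if \<forall>i<?n. H i \<noteq> {} then delta ^ 2 else 1))"
    unfolding bracket_def sum_states by (rule sum.cong[OF refl summand])
  also have "\<dots> = (\<Sum>H\<in>families a. g H + W * (if \<forall>i<?n. H i \<noteq> {} then g H else 0))"
  proof -
    have "g H * (if P then delta ^ 2 else 1) = g H + W * (if P then g H else 0)" for P H
      by (simp add: W_def algebra_simps)
    then show ?thesis by (simp only:)
  qed
  also have "\<dots> = (\<Sum>H\<in>families a. g H) + W * (\<Sum>H\<in>families a. if \<forall>i<?n. H i \<noteq> {} then g H else 0)"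
    by (simp add: sum.distrib sum_distrib_left)
  also have "(\<Sum>H\<in>families a. if \<forall>i<?n. H i \<noteq> {} then g H else 0)
      = (\<Sum>H\<in>Pi\<^sub>E {..<?n} (\<lambda>i. ?P i - {{}}). g H)"
  proof -
    have "finite (families a)" unfolding families_def by (intro finite_PiE) auto
    then have "(\<Sum>H\<in>families a. if \<forall>i<?n. H i \<noteq> {} then g H else 0)
        = (\<Sum>H\<in>{H \<in> families a. \<forall>i<?n. H i \<noteq> {}}. g H)"
      by (simp add: sum.inter_filter)
    moreover have "{H \<in> families a. \<forall>i<?n. H i \<noteq> {}} = Pi\<^sub>E {..<?n} (\<lambda>i. ?P i - {{}})"
      by (rule set_eqI, simp only: families_def PiE_iff mem_Collect_eq Diff_iff singleton_iff lessThan_iff) blast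
    ultimately show ?thesis by simp
  qed
  also have "\<dots> = (\<Prod>i<?n. \<Sum>X\<in>?P i - {{}}. column_weight (a ! i) X)"
    unfolding g_def by (subst prod_sum_PiE) auto
  also have "(\<Sum>H\<in>families a. g H) = (\<Prod>i<?n. \<Sum>X\<in>?P i. column_weight (a ! i) X)"
    unfolding g_def families_def by (subst prod_sum_PiE) auto
  finally have "delta ^ ?n * bracket (pretzel a) =
     (\<Prod>i<?n. delta * (\<Sum>X\<in>?P i. column_weight (a ! i) X)) +
     W * (\<Prod>i<?n. delta * (\<Sum>X\<in>?P i - {{}}. column_weight (a ! i) X))"
    by (simp add: prod.distrib algebra_simps)
  also have "\<dots> = (\<Prod>i<?n. A_pow (a ! i)) * two_products a"
    unfolding column_height_def column_sum column_sum_blocked two_products_def prod_nth[symmetric] prod.distrib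
    by (simp only: distrib_left mult.left_commute)
  also have "(\<Prod>i<?n. A_pow (a ! i)) = A_pow (sum_list a)"
    by (simp add: A_pow_sum[symmetric] sum_list_sum_nth atLeast0LessThan)
  finally show ?thesis .
qed

section \<open>Extreme exponents of Laurent polynomials\<close>

text \<open>For \<open>e = 1\<close> this says that \<open>q\<close> is the lowest exponent, for \<open>e = - 1\<close> that it is the highest one.  The sign \<open>e\<close> lets one
argument serve both ends of a polynomial.\<close>

definition extreme :: "rat \<Rightarrow> rat \<Rightarrow> laurent \<Rightarrow> bool" where
  "extreme e q p \<longleftrightarrow> q \<in> Poly_Mapping.keys p \<and> (\<forall>k\<in>Poly_Mapping.keys p. e * q \<le> e * k)"

lemma extreme_unit: "extreme e q (t_pow q)"
  by (simp add: extreme_def t_pow_def)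

lemma keys_mult_above:
  assumes "\<forall>k\<in>Poly_Mapping.keys p. m \<le> e * k" "\<forall>k\<in>Poly_Mapping.keys r. l < e * (k :: rat)"
  shows "\<forall>k\<in>Poly_Mapping.keys (p * r). m + l < e * k"
proof
  fix k assume "k \<in> Poly_Mapping.keys (p * r)"
  then obtain i j where "k = i + j" "i \<in> Poly_Mapping.keys p" "j \<in> Poly_Mapping.keys r"
    using keys_mult by blast
  then show "m + l < e * k" using assms by (auto simp: distrib_left intro: add_le_less_mono)
qed

lemma extreme_add:
  assumes "c \<noteq> 0" "\<forall>k\<in>Poly_Mapping.keys r. e * q < e * k"
  shows "extreme e q (Poly_Mapping.single q c + r)"
proof -
  have "q \<notin> Poly_Mapping.keys r" using assms by blast
  then have "Poly_Mapping.lookup (Poly_Mapping.single q c + r) q = c"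
    by (simp add: lookup_add in_keys_iff)
  moreover have "Poly_Mapping.keys (Poly_Mapping.single q c + r) \<subseteq> {q} \<union> Poly_Mapping.keys r"
    using Poly_Mapping.keys_add[of "Poly_Mapping.single q c" r] by (auto split: if_splits)
  ultimately show ?thesis using assms unfolding extreme_def in_keys_iff[of q] by fastforce
qed

lemma extreme_split:
  assumes "extreme e q p" "e \<noteq> 0"
  obtains c r where "c \<noteq> 0" "p = Poly_Mapping.single q c + r" "\<forall>k\<in>Poly_Mapping.keys r. e * q < e * k"
proof
  let ?c = "Poly_Mapping.lookup p q"
  let ?r = "p - Poly_Mapping.single q ?c"
  show "?c \<noteq> 0" using assms by (simp add: extreme_def in_keys_iff)
  show "p = Poly_Mapping.single q ?c + ?r" by simp
  show "\<forall>k\<in>Poly_Mapping.keys ?r. e * q < e * k"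
  proof
    fix k assume "k \<in> Poly_Mapping.keys ?r"
    then have "k \<noteq> q" "k \<in> Poly_Mapping.keys p"
      by (auto simp: in_keys_iff lookup_minus lookup_single when_def split: if_splits)
    then show "e * q < e * k" using assms by (auto simp: extreme_def less_le)
  qed
qed

text \<open>The coefficients form an integral domain, so the product of the extreme terms cannot vanish.\<close>

lemma extreme_mult:
  assumes "extreme e q p" "extreme e s r" "e \<noteq> 0"
  shows "extreme e (q + s) (p * r)"
proof -
  obtain c p' where p: "c \<noteq> 0" "p = Poly_Mapping.single q c + p'" "\<forall>k\<in>Poly_Mapping.keys p'. e * q < e * k"
    using assms extreme_split by blast
  obtain d r' where r: "d \<noteq> 0" "r = Poly_Mapping.single s d + r'" "\<forall>k\<in>Poly_Mapping.keys r'. e * s < e * k"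
    using assms extreme_split by blast
  let ?R = "Poly_Mapping.single q c * r' + r * p'"
  have "p * r = Poly_Mapping.single (q + s) (c * d) + ?R"
    by (simp add: p r algebra_simps mult_single)
  moreover have "\<forall>k\<in>Poly_Mapping.keys (Poly_Mapping.single q c * r'). e * q + e * s < e * k"
    by (rule keys_mult_above) (use r in auto)
  moreover have "\<forall>k\<in>Poly_Mapping.keys (r * p'). e * s + e * q < e * k"
    by (rule keys_mult_above) (use assms p in \<open>auto simp: extreme_def\<close>)
  ultimately show ?thesis
    using p r Poly_Mapping.keys_add[of "Poly_Mapping.single q c * r'" "r * p'"]
    by (auto intro!: extreme_add simp: distrib_left add.commute)
qed

lemma extreme_Min: "p \<noteq> 0 \<Longrightarrow> extreme 1 (Min (Poly_Mapping.keys p)) p"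
  by (simp add: extreme_def)

lemma extreme_Max: "p \<noteq> 0 \<Longrightarrow> extreme (- 1) (Max (Poly_Mapping.keys p)) p"
  by (simp add: extreme_def)

lemma degree_span_extreme:
  assumes "extreme 1 lo p" "extreme (- 1) hi p"
  shows "degree_span p = hi - lo"
proof -
  have "Min (Poly_Mapping.keys p) = lo" "Max (Poly_Mapping.keys p) = hi"
    using assms by (auto simp: extreme_def intro!: Min_eqI Max_eqI)
  then show ?thesis by (simp add: degree_span_def)
qed

lemma degree_span_mult:
  assumes "p \<noteq> 0" "r \<noteq> 0"
  shows "degree_span (p * r) = degree_span p + degree_span r"
proof -
  have "degree_span (p * r) = (Max (Poly_Mapping.keys p) + Max (Poly_Mapping.keys r)) -
      (Min (Poly_Mapping.keys p) + Min (Poly_Mapping.keys r))"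
    using assms by (intro degree_span_extreme extreme_mult extreme_Min extreme_Max) auto
  then show ?thesis by (simp add: degree_span_def)
qed

lemma degree_span_uminus: "degree_span (- p) = degree_span p"
  by (simp add: degree_span_def)

lemma t_pow_nonzero: "t_pow q \<noteq> 0"
  by (metis lookup_single_eq lookup_zero one_neq_zero t_pow_def)

lemma degree_span_t_pow_mult: "p \<noteq> 0 \<Longrightarrow> degree_span (t_pow q * p) = degree_span p"
proof -
  assume "p \<noteq> 0"
  moreover have "degree_span (t_pow q) = q - q"
    by (rule degree_span_extreme) (rule extreme_unit)+
  ultimately show ?thesis by (simp add: degree_span_mult t_pow_nonzero)
qed

lemma extreme_uminus: "extreme e q (- p) \<longleftrightarrow> extreme e q p"
  by (simp add: extreme_def)

lemma degree_span_delta: "delta \<noteq> 0" "degree_span delta = 1"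
proof -
  have d: "delta = - (t_pow (- 1 / 2) + t_pow (1 / 2))"
    by (simp add: delta_def A_pow_def)
  have "extreme 1 (- 1 / 2) (t_pow (- 1 / 2) + t_pow (1 / 2))"
    unfolding t_pow_def by (rule extreme_add) auto
  moreover have "extreme (- 1) (1 / 2) (t_pow (- 1 / 2) + t_pow (1 / 2))"
    unfolding t_pow_def by (subst add.commute, rule extreme_add) auto
  ultimately have e: "extreme 1 (- 1 / 2) delta" "extreme (- 1) (1 / 2) delta"
    unfolding d extreme_uminus .
  show "delta \<noteq> 0" using e(1) by (auto simp: extreme_def)
  show "degree_span delta = 1" using degree_span_extreme[OF e] by simp
qed

lemma degree_span_delta_power: "degree_span (delta ^ n) = of_nat n"
proof (induction n)
  case 0
  then show ?case by (simp add: degree_span_def)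
next
  case (Suc n)
  then show ?case by (simp add: degree_span_mult degree_span_delta)
qed

text \<open>The normalisation by the writhe is a unit, and the \<open>n\<close> factors \<open>delta\<close> in the formula for the bracket each have span 1.\<close>

lemma degree_span_jones:
  assumes "a \<noteq> []" "two_products a \<noteq> 0"
  shows "degree_span (jones (pretzel a) up) = degree_span (two_products a) - of_nat (length a)"
proof -
  have "delta ^ length a * bracket (pretzel a) \<noteq> 0"
    using assms t_pow_nonzero unfolding bracket_pretzel[OF assms(1)] A_pow_def by simp
  then have b: "bracket (pretzel a) \<noteq> 0" by auto
  have "degree_span (jones (pretzel a) up) = degree_span (bracket (pretzel a))"
    using b by (simp add: jones_def A_pow_def degree_span_t_pow_mult degree_span_uminus)
  moreover have "degree_span (delta ^ length a * bracket (pretzel a)) =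
      of_nat (length a) + degree_span (bracket (pretzel a))"
    using b by (simp add: degree_span_mult degree_span_delta degree_span_delta_power)
  moreover have "degree_span (delta ^ length a * bracket (pretzel a)) = degree_span (two_products a)"
    using assms by (simp add: bracket_pretzel A_pow_def degree_span_t_pow_mult)
  ultimately show ?thesis by simp
qed

section \<open>Lowest terms when the two products cancel\<close>

text \<open>The indeterminate; it stands for \<open>- t\<close>, or for \<open>- 1/t\<close> when the highest exponents are computed.\<close>

definition Y :: "int poly" where "Y = [:0, 1:]"

text \<open>This is \<open>- y * W\<close> as a polynomial.\<close>

definition U :: "int poly" where "U = 1 - Y + Y ^ 2"

text \<open>\<open>p = c y^m + (higher terms)\<close>, where \<open>c = 0\<close> is permitted.  Keeping \<open>c\<close> explicit makes it possible to see when lowest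
terms cancel.\<close>

definition low :: "int poly \<Rightarrow> nat \<Rightarrow> int \<Rightarrow> bool" where
  "low p m c \<longleftrightarrow> (\<exists>q. p = Y ^ m * (of_int c + Y * q))"

lemma lowI: "p = Y ^ m * (of_int c + Y * q) \<Longrightarrow> low p m c"
  by (auto simp: low_def)

lemma low_mult:
  assumes "low p m c" "low q k d"
  shows "low (p * q) (m + k) (c * d)"
proof -
  obtain p' q' where "p = Y ^ m * (of_int c + Y * p')" "q = Y ^ k * (of_int d + Y * q')"
    using assms by (auto simp: low_def)
  then have "p * q = Y ^ (m + k) * (of_int (c * d) + Y * (p' * of_int d + of_int c * q' + Y * p' * q'))"
    by (simp add: algebra_simps power_add)
  then show ?thesis by (rule lowI)
qed

lemma low_prod_list:
  assumes "\<And>x. x \<in> set xs \<Longrightarrow> low (f x) (m x) 1"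
  shows "low (\<Prod>x\<leftarrow>xs. f x) (\<Sum>x\<leftarrow>xs. m x) 1"
  using assms
proof (induction xs)
  case Nil
  then show ?case by (auto intro: lowI[where q = 0])
next
  case (Cons x xs)
  then show ?case using low_mult[of "f x" "m x" 1] by fastforce
qed

lemma low_add_higher:
  assumes "low p m c" "Y ^ Suc m dvd r"
  shows "low (p + r) m c"
proof -
  obtain q r' where "p = Y ^ m * (of_int c + Y * q)" "r = Y ^ Suc m * r'"
    using assms by (auto simp: low_def dvd_def)
  then have "p + r = Y ^ m * (of_int c + Y * (q + r'))"
    by (simp add: algebra_simps)
  then show ?thesis by (rule lowI)
qed

lemma low_dvd: "low p m c \<Longrightarrow> k \<le> m \<Longrightarrow> Y ^ k dvd p"
  unfolding low_def by (metis dvd_mult2 le_imp_power_dvd)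

lemma low_minus: "low p m c \<Longrightarrow> low (- p) m (- c)"
  unfolding low_def
proof (elim exE)
  fix q assume "p = Y ^ m * (of_int c + Y * q)"
  then have "- p = Y ^ m * (of_int (- c) + Y * (- q))"
    by (simp add: algebra_simps)
  then show "\<exists>q. - p = Y ^ m * (of_int (- c) + Y * q)" by blast
qed

lemma low_add_eq:
  assumes "low p m c" "low r m d"
  shows "low (p + r) m (c + d)"
proof -
  obtain q r' where "p = Y ^ m * (of_int c + Y * q)" "r = Y ^ m * (of_int d + Y * r')"
    using assms by (auto simp: low_def)
  then have "p + r = Y ^ m * (of_int (c + d) + Y * (q + r'))"
    by (simp add: algebra_simps)
  then show ?thesis by (rule lowI)
qed

lemma low_add_lt: "low p m c \<Longrightarrow> low r k d \<Longrightarrow> m < k \<Longrightarrow> low (p + r) m c"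
  by (rule low_add_higher[OF _ low_dvd]) auto

text \<open>Up to units, \<open>y^a + W\<close> is \<open>U - y^(a+1)\<close> for \<open>a \<ge> 0\<close> and \<open>1 - U y^(b-1)\<close> for \<open>a = - b < 0\<close>.\<close>

definition pos_prod :: "nat list \<Rightarrow> int poly" where
  "pos_prod as = (\<Prod>a\<leftarrow>as. U - Y ^ Suc a)"

definition neg_prod :: "nat list \<Rightarrow> int poly" where
  "neg_prod bs = (\<Prod>b\<leftarrow>bs. 1 - U * Y ^ (b - 1))"

definition pure_prod :: "nat list \<Rightarrow> int poly" where
  "pure_prod bs = (\<Prod>b\<leftarrow>bs. 1 - Y ^ b)"

lemma prod_simps [simp]:
  "pos_prod [] = 1" "neg_prod [] = 1" "pure_prod [] = 1"
  "pos_prod (a # as) = (U - Y ^ Suc a) * pos_prod as"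
  "neg_prod (a # as) = (1 - U * Y ^ (a - 1)) * neg_prod as"
  "pure_prod (a # as) = (1 - Y ^ a) * pure_prod as"
  "neg_prod (as @ bs) = neg_prod as * neg_prod bs"
  "pure_prod (as @ bs) = pure_prod as * pure_prod bs"
  by (simp_all add: pos_prod_def neg_prod_def pure_prod_def)

text \<open>All products of two or more of the terms \<open>U y^(b-1)\<close> have order at least \<open>2m + 2 \<ge> m + 2\<close>; so only the entries of
minimal size contribute to the first correction.\<close>

lemma neg_prod_expand:
  assumes "\<forall>b\<in>set bs. Suc (Suc m) \<le> b"
  obtains q where "neg_prod bs =
     1 - of_nat (count_list bs (Suc (Suc m))) * Y ^ Suc m + Y ^ Suc (Suc m) * q"
  using assms
proof (induction bs arbitrary: thesis)
  case Nil
  show ?case by (rule Nil(1)[of 0]) simp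
next
  case (Cons b bs)
  obtain q where q: "neg_prod bs =
     1 - of_nat (count_list bs (Suc (Suc m))) * Y ^ Suc m + Y ^ Suc (Suc m) * q"
    using Cons by (metis list.set_intros(2))
  define k :: "int poly" where "k = of_nat (count_list bs (Suc (Suc m)))"
  show ?case
  proof (cases "b = Suc (Suc m)")
    case True
    have "neg_prod (b # bs) = 1 - (1 + k) * Y ^ Suc m + Y ^ Suc (Suc m) *
        (q + 1 - Y + U * (k - Y * q) * Y ^ m)"
      using True unfolding prod_simps q k_def[symmetric]
      by (simp add: U_def algebra_simps power2_eq_square)
    then show ?thesis
      using Cons(2)[of "q + 1 - Y + U * (k - Y * q) * Y ^ m"] True by (simp add: k_def)
  next
    case False
    then obtain j where j: "b = Suc (Suc (Suc m)) + j"
      using Cons(3) by (metis le_add_diff_inverse le_neq_implies_less list.set_intros(1) Suc_leI)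
    have "neg_prod (b # bs) = 1 - k * Y ^ Suc m + Y ^ Suc (Suc m) *
        (q - U * Y ^ j * neg_prod bs)"
      unfolding prod_simps q k_def[symmetric] j
      by (simp add: algebra_simps power_add)
    then show ?thesis
      using Cons(2)[of "q - U * Y ^ j * neg_prod bs"] j by (simp add: k_def)
  qed
qed

lemma pure_prod_expand:
  assumes "\<forall>b\<in>set bs. m \<le> b"
  obtains q where "pure_prod bs = 1 + Y ^ m * q"
  using assms
proof (induction bs arbitrary: thesis)
  case Nil
  show ?case by (rule Nil(1)[of 0]) simp
next
  case (Cons b bs)
  obtain q where q: "pure_prod bs = 1 + Y ^ m * q"
    using Cons by (metis list.set_intros(2))
  obtain j where j: "b = m + j" using Cons(3) by (metis le_iff_add list.set_intros(1))
  show ?case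
    by (rule Cons(2)[of "q - Y ^ j * pure_prod bs"])
       (simp add: j q algebra_simps power_add)
qed

lemma pos_prod_expand:
  assumes "\<forall>a\<in>set as. 2 \<le> a"
  obtains q where "pos_prod as = 1 - of_nat (length as) * Y + Y ^ 2 * q"
  using assms
proof (induction as arbitrary: thesis)
  case Nil
  show ?case by (rule Nil(1)[of 0]) simp
next
  case (Cons a as)
  obtain q where q: "pos_prod as = 1 - of_nat (length as) * Y + Y ^ 2 * q"
    using Cons by (metis list.set_intros(2))
  define k :: "int poly" where "k = of_nat (length as)"
  obtain j where j: "a = 2 + j" using Cons(3) by (metis le_iff_add list.set_intros(1))
  have "pos_prod (a # as) = 1 - (1 + k) * Y + Y ^ 2 *
        (q + k - Y * q + (1 - Y ^ Suc j) * pos_prod as)"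
    unfolding prod_simps q k_def[symmetric] j
    by (simp add: U_def algebra_simps power2_eq_square)
  then show ?case
    using Cons(2)[of "q + k - Y * q + (1 - Y ^ Suc j) * pos_prod as"] by (simp add: k_def)
qed

text \<open>The coefficient of \<open>y\<close> is \<open>1 - k - l\<close> if there are \<open>k\<close> positive entries and \<open>l\<close> entries equal to \<open>- 2\<close>: each positive entry contributes
\<open>- 1\<close> through \<open>U = 1 - y + ...\<close>, each entry \<open>- 2\<close> contributes \<open>- 1\<close>, and the single \<open>U\<close> of the second product contributes \<open>1\<close>.
Hence it cannot vanish for \<open>k \<ge> 2\<close>.\<close>

lemma low_several_positive:
  assumes as: "\<forall>a\<in>set as. 2 \<le> a" and bs: "\<forall>b\<in>set bs. 2 \<le> b" and "2 \<le> length as"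
  shows "\<exists>c. c \<noteq> 0 \<and> low (pos_prod as * neg_prod bs - U * pure_prod as * pure_prod bs) 1 c"
proof -
  obtain q1 where q1: "pos_prod as = 1 - of_nat (length as) * Y + Y ^ 2 * q1"
    using as by (rule pos_prod_expand)
  obtain q2 where q2: "neg_prod bs = 1 - of_nat (count_list bs 2) * Y + Y ^ 2 * q2"
    using bs neg_prod_expand[of bs 0] by (auto simp: numeral_2_eq_2)
  obtain q3 where q3: "pure_prod as = 1 + Y ^ 2 * q3"
    using as by (rule pure_prod_expand)
  obtain q4 where q4: "pure_prod bs = 1 + Y ^ 2 * q4"
    using bs by (rule pure_prod_expand)
  define k :: "int poly" where "k = of_nat (length as)"
  define l :: "int poly" where "l = of_nat (count_list bs 2)"
  have "\<exists>q. (1 - k * Y + Y ^ 2 * q1) * (1 - l * Y + Y ^ 2 * q2)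
      - U * (1 + Y ^ 2 * q3) * (1 + Y ^ 2 * q4) = Y * ((1 - k - l) + Y * q)"
    by (rule exI[of _ "k * l - k * Y * q2 - l * Y * q1 + q1 + q2 + Y ^ 2 * q1 * q2 - 1
      - U * (q3 + q4 + Y ^ 2 * q3 * q4)"])
       (simp add: U_def algebra_simps power2_eq_square)
  then obtain q where "(1 - k * Y + Y ^ 2 * q1) * (1 - l * Y + Y ^ 2 * q2)
      - U * (1 + Y ^ 2 * q3) * (1 + Y ^ 2 * q4) = Y * ((1 - k - l) + Y * q)" ..
  then have "low (pos_prod as * neg_prod bs - U * pure_prod as * pure_prod bs) 1
      (1 - int (length as) - int (count_list bs 2))"
    by (intro lowI[of _ _ _ q]) (simp add: q1 q2 q3 q4 k_def l_def)
  then show ?thesis using assms(3) by (intro exI conjI) auto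
qed

text \<open>The difference of the two products for one positive entry \<open>a\<close> and negative entries \<open>- b\<close>, \<open>b \<in> bs\<close>, divided by their common lowest
power of \<open>y\<close>.  For \<open>a \<ge> 1\<close> and \<open>b \<ge> 2\<close> both products start with 1, so the
difference has positive order.\<close>

definition defect :: "nat \<Rightarrow> nat list \<Rightarrow> int poly" where
  "defect a bs = (U - Y ^ Suc a) * neg_prod bs - U * (1 - Y ^ a) * pure_prod bs"

lemma neg_prod_unit:
  assumes "\<forall>b\<in>set bs. 2 \<le> b"
  obtains q where "neg_prod bs = 1 + Y * q"
proof -
  obtain q where "neg_prod bs = 1 - of_nat (count_list bs 2) * Y + Y ^ 2 * q"
    using assms neg_prod_expand[of bs 0] by (auto simp: numeral_2_eq_2)
  then show ?thesis
    by (intro that[of "Y * q - of_nat (count_list bs 2)"])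
       (simp add: algebra_simps power2_eq_square)
qed

text \<open>Every factor for an entry \<open>b \<ge> m + 2\<close> of \<open>rest\<close> is \<open>1\<close> up to terms of order \<open>m + 1\<close>, and the factors in front of the sum of these
terms start with 1.\<close>

lemma defect_append:
  assumes "1 \<le> a" "\<forall>b\<in>set pre. 2 \<le> b" "\<forall>b\<in>set rest. Suc (Suc m) \<le> b"
  obtains q where "defect a (pre @ rest) = defect a pre +
    Y ^ Suc m * (- of_nat (count_list rest (Suc (Suc m))) + Y * q)"
proof -
  obtain q1 where q1: "neg_prod pre = 1 + Y * q1"
    using assms(2) by (rule neg_prod_unit)
  define k :: "int poly" where "k = of_nat (count_list rest (Suc (Suc m)))"
  obtain q2 where q2: "neg_prod rest = 1 - k * Y ^ Suc m + Y ^ Suc (Suc m) * q2"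
    unfolding k_def using assms(3) by (rule neg_prod_expand)
  obtain q3 where q3: "pure_prod rest = 1 + Y ^ Suc (Suc m) * q3"
    using assms(3) by (rule pure_prod_expand)
  define A where "A = U - Y ^ Suc a"
  have A: "A = 1 + Y * (Y - 1 - Y ^ a)"
    by (simp add: A_def U_def algebra_simps power2_eq_square)
  have "defect a (pre @ rest) = defect a pre + A * neg_prod pre * (Y ^ Suc m * (- k + Y * q2))
      - U * (1 - Y ^ a) * pure_prod pre * (Y ^ Suc (Suc m) * q3)"
    unfolding defect_def A_def[symmetric] prod_simps q2 q3 by (simp add: algebra_simps)
  also have "A * neg_prod pre = 1 + Y * ((Y - 1 - Y ^ a) + q1 + Y * q1 * (Y - 1 - Y ^ a))"
    unfolding A q1 by (simp add: algebra_simps)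
  finally show ?thesis
    by (intro that[of "q2 + ((Y - 1 - Y ^ a) + q1 + Y * q1 * (Y - 1 - Y ^ a)) * (- k + Y * q2)
       - U * (1 - Y ^ a) * pure_prod pre * q3"])
       (simp add: k_def[symmetric] algebra_simps)
qed

text \<open>So the order of \<open>defect\<close> for a long list is decided by a competition between the order for a short initial segment
and the size of the next entry \<open>n\<close>.\<close>

lemma low_defect_append:
  assumes "1 \<le> a" "\<forall>b\<in>set pre. 2 \<le> b" "\<forall>b\<in>set rest. n \<le> b" "2 \<le> n"
    and "n \<in> set rest" "low (defect a pre) m c"
  shows "n - 1 < m \<Longrightarrow> low (defect a (pre @ rest)) (n - 1) (- int (count_list rest n))"
    and "n - 1 = m \<Longrightarrow> low (defect a (pre @ rest)) m (c - int (count_list rest n))"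
    and "n - 1 > m \<Longrightarrow> low (defect a (pre @ rest)) m c"
proof -
  define n' where "n' = n - 2"
  have n: "n = Suc (Suc n')" using assms(4) by (simp add: n'_def)
  obtain q where q: "defect a (pre @ rest) = defect a pre +
    Y ^ Suc n' * (- of_nat (count_list rest (Suc (Suc n'))) + Y * q)"
    using assms(1-3) unfolding n by (rule defect_append)
  define r where "r = Y ^ Suc n' * (- of_nat (count_list rest (Suc (Suc n'))) + Y * q)"
  have r: "low r (n - 1) (- int (count_list rest n))"
    unfolding r_def n by (rule lowI[of _ _ _ q]) simp
  have e: "defect a (pre @ rest) = defect a pre + r" by (simp add: q r_def)
  show "n - 1 < m \<Longrightarrow> low (defect a (pre @ rest)) (n - 1) (- int (count_list rest n))"
    unfolding e add.commute[of _ r] by (rule low_add_lt[OF r assms(6)])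
  show "n - 1 = m \<Longrightarrow> low (defect a (pre @ rest)) m (c - int (count_list rest n))"
    unfolding e using low_add_eq[OF assms(6), of r "- int (count_list rest n)"] r by simp
  show "n - 1 > m \<Longrightarrow> low (defect a (pre @ rest)) m c"
    unfolding e by (rule low_add_lt[OF assms(6) r])
qed

lemma low_defect_0: "low (defect a []) a 1"
  by (rule lowI[where q = "Y - 2"])
     (simp add: defect_def U_def algebra_simps power2_eq_square)

lemma low_defect_1: "1 \<le> a \<Longrightarrow> low (defect a [Suc a]) (Suc a) 1"
  by (rule lowI[where q = "- 3 + 3 * Y - Y ^ 2"])
     (simp add: defect_def U_def algebra_simps power2_eq_square power_add)

text \<open>The three summands are what remains of the linear, the quadratic and the cubic terms.  For \<open>a \<ge> 3\<close> the first one is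
the lowest; for \<open>a = 2\<close> the first two have the same order and cancel; for \<open>a = 1\<close> the second one is the lowest.\<close>

lemma defect_2:
  "defect a [Suc a, Suc (Suc a)] = (1 - Y) ^ 2 *
     (- (Y ^ (a + 3)) + U * (1 + Y ^ 2) * Y ^ (2 * a + 1) - U * Y ^ (3 * a + 2))"
proof -
  have e: "Y ^ (2 * a + 1) = Y * (Y ^ a * Y ^ a)" "Y ^ (3 * a + 2) = Y ^ 2 * (Y ^ a * (Y ^ a * Y ^ a))"
     "Y ^ (a + 3) = Y ^ 3 * Y ^ a"
    by (simp_all add: mult_2 power_add power_mult numeral_3_eq_3 power2_eq_square algebra_simps)
  show ?thesis unfolding e
    apply (simp add: defect_def U_def power_add)
    apply (simp add: algebra_simps power2_eq_square power3_eq_cube)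
    done
qed

lemma low_defect_2:
  shows "low (defect 1 [2, 3]) 3 1"
    and "low (defect 2 [3, 4]) 6 (- 1)"
    and "3 \<le> a \<Longrightarrow> low (defect a [Suc a, Suc (Suc a)]) (a + 3) (- 1)"
proof -
  show "low (defect 1 [2, 3]) 3 1"
    by (rule lowI[where q = "- 4 + 6 * Y - 4 * Y ^ 2 + Y ^ 3"])
       (simp add: defect_def U_def algebra_simps eval_nat_numeral)
  show "low (defect 2 [3, 4]) 6 (- 1)"
    by (rule lowI[where q = "4 - 7 * Y + 8 * Y ^ 2 - 7 * Y ^ 3 + 4 * Y ^ 4 - Y ^ 5"])
       (simp add: defect_def U_def algebra_simps eval_nat_numeral)
  assume "3 \<le> a"
  then obtain j where j: "a = 3 + j" using le_iff_add by auto
  define z where "z = Y ^ j"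
  have "2 * a + 1 = 7 + (j + j)" "3 * a + 2 = 11 + (j + (j + j))" "a + 3 = 6 + j"
    by (simp_all add: j)
  then have e: "Y ^ (2 * a + 1) = Y ^ 7 * (z * z)" "Y ^ (3 * a + 2) = Y ^ 11 * (z * (z * z))"
     "Y ^ (a + 3) = Y ^ 6 * z"
    by (simp_all only: z_def power_add)
  show "low (defect a [Suc a, Suc (Suc a)]) (a + 3) (- 1)"
    unfolding defect_2 unfolding low_def e
    by (rule exI[of _ "2 - Y + (1 - Y) ^ 2 * (U * (1 + Y ^ 2) * z - U * Y ^ 4 * z * z)"])
       (simp add: algebra_simps eval_nat_numeral)
qed

lemma low_defect_3: "low (defect 1 [2, 3, 4]) 6 (- 1)"
  by (rule lowI[where q = "5 - 11 * Y + 15 * Y ^ 2 - 15 * Y ^ 3 + 11 * Y ^ 4 - 5 * Y ^ 5 + Y ^ 6"])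
     (simp add: defect_def U_def algebra_simps eval_nat_numeral)

section \<open>Clearing denominators\<close>

lemma signed_pow_0: "signed_pow 0 = 1"
  by (simp add: signed_pow_def t_pow_0)

lemma signed_pow_add: "signed_pow (i + j) = signed_pow i * signed_pow j"
  by (simp add: signed_pow_def t_pow_add)

lemma signed_pow_power: "signed_pow (i * int k) = signed_pow i ^ k"
  by (induction k) (simp_all add: signed_pow_0 signed_pow_add algebra_simps)

text \<open>The substitution \<open>y := (- t)^e\<close>, used for \<open>e = 1\<close> and \<open>e = - 1\<close>.\<close>

definition to_laurent :: "int \<Rightarrow> int poly \<Rightarrow> laurent" where
  "to_laurent e p = poly (map_poly of_int p) (signed_pow e)"

lemma to_laurent_0: "to_laurent e 0 = 0" by (simp add: to_laurent_def)

lemma to_laurent_pCons: "to_laurent e (pCons c p) = of_int c + signed_pow e * to_laurent e p"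
  by (simp add: to_laurent_def map_poly_pCons)

lemma to_laurent_of_int: "to_laurent e (of_int c) = of_int c"
  by (simp add: of_int_poly to_laurent_pCons to_laurent_0)

lemma to_laurent_1: "to_laurent e 1 = 1"
  using to_laurent_of_int[of e 1] by simp

lemma to_laurent_Y: "to_laurent e Y = signed_pow e"
  by (simp add: Y_def to_laurent_pCons to_laurent_0)

lemma to_laurent_add: "to_laurent e (p + q) = to_laurent e p + to_laurent e q"
  by (induction p q rule: poly_induct2) (simp_all add: to_laurent_0 to_laurent_pCons algebra_simps)

lemma to_laurent_uminus: "to_laurent e (- p) = - to_laurent e p"
  using to_laurent_add[of e p "- p"] by (simp add: to_laurent_0 add_eq_0_iff)

lemma to_laurent_diff: "to_laurent e (p - q) = to_laurent e p - to_laurent e q"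
  using to_laurent_add[of e p "- q"] by (simp add: to_laurent_uminus)

lemma to_laurent_smult: "to_laurent e (smult c p) = of_int c * to_laurent e p"
  by (induction p) (simp_all add: to_laurent_0 to_laurent_pCons algebra_simps)

lemma to_laurent_mult: "to_laurent e (p * q) = to_laurent e p * to_laurent e q"
  by (induction p) (simp_all add: to_laurent_0 to_laurent_pCons to_laurent_add to_laurent_smult algebra_simps)

lemma to_laurent_power: "to_laurent e (p ^ k) = to_laurent e p ^ k"
  by (induction k) (simp_all add: to_laurent_1 to_laurent_mult)

lemmas to_laurent_simps = to_laurent_add to_laurent_uminus to_laurent_diff to_laurent_mult to_laurent_power to_laurent_1 to_laurent_Y to_laurent_of_int

lemma keys_signed_pow: "Poly_Mapping.keys (signed_pow x) = {of_int x}"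
  by (simp add: signed_pow_def t_pow_def)

lemma keys_of_int: "Poly_Mapping.keys (of_int c :: laurent) \<subseteq> {0}"
  by (metis keys_single single_of_int empty_subsetI subset_refl)

lemma keys_to_laurent:
  assumes "e = 1 \<or> e = - 1"
  shows "\<forall>k\<in>Poly_Mapping.keys (to_laurent e p). 0 \<le> of_int e * k"
proof (induction p)
  case 0
  then show ?case by (simp add: to_laurent_0)
next
  case (pCons c p)
  have "\<forall>k\<in>Poly_Mapping.keys (to_laurent e p * signed_pow e). 0 + 0 < of_int e * k"
    using pCons assms by (intro keys_mult_above) (auto simp: keys_signed_pow)
  then show ?case
    using Poly_Mapping.keys_add[of "of_int c" "signed_pow e * to_laurent e p"] keys_of_int[of c]
    by (fastforce simp: to_laurent_pCons mult.commute)
qed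

lemma extreme_signed_pow: "extreme e (of_int x) (signed_pow x)"
  by (simp add: extreme_def keys_signed_pow)

lemma extreme_to_laurent:
  assumes "low p m c" "c \<noteq> 0" "e = 1 \<or> e = - 1"
  shows "extreme (of_int e) (of_int (e * int m)) (to_laurent e p)"
proof -
  obtain q where q: "p = Y ^ m * (of_int c + Y * q)" using assms(1) by (auto simp: low_def)
  have "Poly_Mapping.single 0 (of_int c :: int) = (of_int c :: laurent)"
    by (rule single_of_int)
  then have s: "Poly_Mapping.single 0 c = (of_int c :: laurent)"
    by (simp only: of_int_eq_id id_apply)
  have "extreme (of_int e) 0 (Poly_Mapping.single 0 c + to_laurent e q * signed_pow e)"
  proof (rule extreme_add)
    have "\<forall>k\<in>Poly_Mapping.keys (to_laurent e q * signed_pow e). 0 + 0 < of_int e * k"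
      using keys_to_laurent[OF assms(3)] assms(3) by (intro keys_mult_above) (auto simp: keys_signed_pow)
    then show "\<forall>k\<in>Poly_Mapping.keys (to_laurent e q * signed_pow e). of_int e * 0 < of_int e * k" by simp
  qed fact
  then have "extreme (of_int e) (of_int (e * int m) + 0) (signed_pow (e * int m) * (of_int c + signed_pow e * to_laurent e q))"
    unfolding s using assms(3)
    by (intro extreme_mult extreme_signed_pow) (auto simp: mult.commute)
  then show ?thesis by (simp add: q to_laurent_simps signed_pow_power)
qed

text \<open>The two factors of an entry \<open>x\<close>, freed from negative powers of \<open>y\<close> and, for \<open>x \<ge> 0\<close>, with the sign changed.\<close>

definition first_factor :: "int \<Rightarrow> int poly" where
  "first_factor x = (if 0 \<le> x then U - Y ^ Suc (nat x) else 1 - U * Y ^ (nat (- x) - 1))"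

definition second_factor :: "int \<Rightarrow> int poly" where
  "second_factor x = 1 - Y ^ nat \<bar>x\<bar>"

definition nonneg_count :: "int list \<Rightarrow> nat" where
  "nonneg_count a = length (filter (\<lambda>x. 0 \<le> x) a)"

definition neg_part :: "int list \<Rightarrow> nat" where
  "neg_part a = (\<Sum>x\<leftarrow>a. nat (- x))"

text \<open>\<open>two_products\<close> multiplied by \<open>\<plusminus> y^(N + B + 1)\<close>, where \<open>N\<close> is the number of nonnegative entries and \<open>- B\<close> is the
sum of the negative ones; see \<open>clear_denominators\<close>.\<close>

definition cleared :: "int list \<Rightarrow> int poly" where
  "cleared a = Y * (\<Prod>x\<leftarrow>a. first_factor x) - Y ^ nonneg_count a * U * (\<Prod>x\<leftarrow>a. second_factor x)"

lemma W_eq: "W = 1 - signed_pow 1 - signed_pow (- 1)"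
  by (simp add: W_def delta_def signed_pow_def A_pow_def power2_eq_square algebra_simps t_pow_add[symmetric] t_pow_0)

lemma to_laurent_U:
  assumes "e = 1 \<or> e = - 1"
  shows "signed_pow e * W = - to_laurent e U"
  using assms by (auto simp: W_eq U_def to_laurent_simps algebra_simps signed_pow_add[symmetric] signed_pow_0 power2_eq_square)

lemma clear_first:
  assumes e: "e = 1 \<or> e = - 1"
  shows "signed_pow (e * int (nonneg_count a + neg_part a)) * (\<Prod>x\<leftarrow>a. signed_pow (e * x) + W)
    = (- 1) ^ nonneg_count a * to_laurent e (\<Prod>x\<leftarrow>a. first_factor x)"
proof (induction a)
  case Nil
  then show ?case by (simp add: nonneg_count_def neg_part_def signed_pow_0 to_laurent_1)
next
  case (Cons x a)
  define k where "k = int (nonneg_count a + neg_part a)"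
  show ?case
  proof (cases "0 \<le> x")
    case True
    then have N: "nonneg_count (x # a) = Suc (nonneg_count a)" "neg_part (x # a) = neg_part a"
      by (simp_all add: nonneg_count_def neg_part_def)
    have "signed_pow e * (signed_pow (e * x) + W) = signed_pow e * signed_pow e ^ nat x - to_laurent e U"
      using True to_laurent_U[OF e] signed_pow_power[of e "nat x"] by (simp add: distrib_left)
    also have "\<dots> = - to_laurent e (first_factor x)"
      using True by (simp add: first_factor_def to_laurent_simps)
    finally have f: "signed_pow e * (signed_pow (e * x) + W) = - to_laurent e (first_factor x)" .
    have "signed_pow (e * int (nonneg_count (x # a) + neg_part (x # a))) = signed_pow e * signed_pow (e * k)"
      unfolding N k_def by (simp add: signed_pow_add[symmetric] algebra_simps)
    then have "signed_pow (e * int (nonneg_count (x # a) + neg_part (x # a))) * (\<Prod>x\<leftarrow>x # a. signed_pow (e * x) + W)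
      = (signed_pow e * (signed_pow (e * x) + W)) * (signed_pow (e * k) * (\<Prod>x\<leftarrow>a. signed_pow (e * x) + W))"
      by (simp only: list.map prod_list.Cons ac_simps)
    then show ?thesis using Cons unfolding f k_def by (simp add: N to_laurent_mult)
  next
    case False
    define b where "b = nat (- x) - 1"
    have x: "x = - (1 + int b)" "nat (1 + int b) - Suc 0 = b" using False by (simp_all add: b_def)
    have N: "nonneg_count (x # a) = nonneg_count a" "neg_part (x # a) = Suc b + neg_part a"
      using False by (simp_all add: nonneg_count_def neg_part_def b_def)
    have "signed_pow (e * int (Suc b)) * (signed_pow (e * x) + W)
        = signed_pow (e * int (Suc b) + e * x) + signed_pow (e * int b) * (signed_pow e * W)"
      by (simp add: distrib_left signed_pow_add[symmetric] mult.assoc[symmetric]) (simp add: algebra_simps)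
    also have "\<dots> = to_laurent e (first_factor x)"
      using False to_laurent_U[OF e] by (simp add: x first_factor_def to_laurent_simps signed_pow_power signed_pow_0 algebra_simps)
    finally have f: "signed_pow (e * int (Suc b)) * (signed_pow (e * x) + W) = to_laurent e (first_factor x)" .
    have "signed_pow (e * int (nonneg_count (x # a) + neg_part (x # a))) = signed_pow (e * int (Suc b)) * signed_pow (e * k)"
      unfolding N k_def by (simp add: signed_pow_add[symmetric] algebra_simps)
    then have "signed_pow (e * int (nonneg_count (x # a) + neg_part (x # a))) * (\<Prod>x\<leftarrow>x # a. signed_pow (e * x) + W)
      = (signed_pow (e * int (Suc b)) * (signed_pow (e * x) + W)) * (signed_pow (e * k) * (\<Prod>x\<leftarrow>a. signed_pow (e * x) + W))"
      by (simp only: list.map prod_list.Cons ac_simps)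
    then show ?thesis
      unfolding f k_def Cons by (simp only: N(1) to_laurent_mult list.map prod_list.Cons ac_simps)
  qed
qed

lemma clear_second:
  assumes e: "e = 1 \<or> e = - 1"
  shows "signed_pow (e * int (neg_part a)) * (\<Prod>x\<leftarrow>a. signed_pow (e * x) - 1)
    = (- 1) ^ nonneg_count a * to_laurent e (\<Prod>x\<leftarrow>a. second_factor x)"
proof (induction a)
  case Nil
  then show ?case by (simp add: nonneg_count_def neg_part_def signed_pow_0 to_laurent_1)
next
  case (Cons x a)
  let ?s = "if 0 \<le> x then - 1 else 1 :: laurent"
  have N: "(- 1) ^ nonneg_count (x # a) = ?s * (- 1) ^ nonneg_count a"
    "neg_part (x # a) = nat (- x) + neg_part a"
    by (simp_all add: nonneg_count_def neg_part_def)
  have f: "signed_pow (e * int (nat (- x))) * (signed_pow (e * x) - 1) = ?s * to_laurent e (second_factor x)"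
  proof (cases "0 \<le> x")
    case True
    then have "signed_pow (e * x) = signed_pow e ^ nat x" using signed_pow_power[of e "nat x"] by simp
    then show ?thesis using True by (simp add: second_factor_def to_laurent_simps signed_pow_0)
  next
    case False
    then have "signed_pow (e * int (nat (- x))) * signed_pow (e * x) = 1"
      by (simp add: signed_pow_add[symmetric] signed_pow_0)
    moreover have "to_laurent e (second_factor x) = 1 - signed_pow (e * int (nat (- x)))"
      using False by (simp only: signed_pow_power) (simp add: second_factor_def to_laurent_simps)
    ultimately show ?thesis using False by (simp add: right_diff_distrib)
  qed
  have "signed_pow (e * int (neg_part (x # a))) = signed_pow (e * int (nat (- x))) * signed_pow (e * int (neg_part a))"
    unfolding N by (simp add: signed_pow_add[symmetric] algebra_simps del: int_nat_eq)
  then have "signed_pow (e * int (neg_part (x # a))) * (\<Prod>x\<leftarrow>x # a. signed_pow (e * x) - 1)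
      = (signed_pow (e * int (nat (- x))) * (signed_pow (e * x) - 1)) *
        (signed_pow (e * int (neg_part a)) * (\<Prod>x\<leftarrow>a. signed_pow (e * x) - 1))"
    by (simp only: list.map prod_list.Cons ac_simps)
  then show ?case using Cons unfolding f N by (simp add: to_laurent_mult)
qed

lemma clear_denominators:
  assumes e: "e = 1 \<or> e = - 1"
  shows "signed_pow (e * int (nonneg_count a + neg_part a + 1)) * two_products (map ((*) e) a)
    = (- 1) ^ nonneg_count a * to_laurent e (cleared a)"
proof -
  let ?P = "\<Prod>x\<leftarrow>a. signed_pow (e * x) + W" and ?Q = "\<Prod>x\<leftarrow>a. signed_pow (e * x) - 1"
  let ?N = "nonneg_count a" and ?B = "neg_part a"
  have 1: "signed_pow (e * int (?N + ?B + 1)) = signed_pow e * signed_pow (e * int (?N + ?B))"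
    by (simp add: signed_pow_add[symmetric] algebra_simps)
  have 2: "signed_pow (e * int (?N + ?B + 1)) = signed_pow e * signed_pow (e * int ?N) * signed_pow (e * int ?B)"
    by (simp add: signed_pow_add[symmetric] algebra_simps)
  have "signed_pow (e * int (?N + ?B + 1)) * two_products (map ((*) e) a) =
      signed_pow (e * int (?N + ?B + 1)) * ?P + signed_pow (e * int (?N + ?B + 1)) * (W * ?Q)"
    by (simp add: two_products_def o_def distrib_left)
  also have "signed_pow (e * int (?N + ?B + 1)) * ?P =
      signed_pow e * ((- 1) ^ ?N * to_laurent e (\<Prod>x\<leftarrow>a. first_factor x))"
    unfolding 1 mult.assoc clear_first[OF e] ..
  also have "signed_pow (e * int (?N + ?B + 1)) * (W * ?Q) =
      signed_pow (e * int ?N) * (signed_pow e * W) * (signed_pow (e * int ?B) * ?Q)"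
    unfolding 2 by (simp only: ac_simps)
  also have "\<dots> = signed_pow (e * int ?N) * (- to_laurent e U) * ((- 1) ^ ?N * to_laurent e (\<Prod>x\<leftarrow>a. second_factor x))"
    unfolding to_laurent_U[OF e] clear_second[OF e] ..
  also have "signed_pow e * ((- 1) ^ ?N * to_laurent e (\<Prod>x\<leftarrow>a. first_factor x)) +
      signed_pow (e * int ?N) * (- to_laurent e U) * ((- 1) ^ ?N * to_laurent e (\<Prod>x\<leftarrow>a. second_factor x)) =
      (- 1) ^ ?N * to_laurent e (cleared a)"
    by (simp add: cleared_def to_laurent_simps signed_pow_power algebra_simps)
  finally show ?thesis .
qed

text \<open>Since \<open>W\<close> is invariant under \<open>t \<mapsto> 1/t\<close>, the polynomial for the entries \<open>e * x\<close> in \<open>t\<close> is that for the entries \<open>x\<close> in \<open>t^e\<close>.\<close>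

lemma extreme_two_products:
  assumes "low (cleared a) m c" "c \<noteq> 0" and e: "e = 1 \<or> e = - 1"
  shows "extreme (of_int e) (of_int (e * (int m - int (nonneg_count a) - int (neg_part a) - 1)))
    (two_products (map ((*) e) a))"
proof -
  let ?k = "e * int (nonneg_count a + neg_part a + 1)"
  have "extreme (of_int e) (of_int (e * int m)) ((- 1) ^ nonneg_count a * to_laurent e (cleared a))"
    using extreme_to_laurent[OF assms] by (cases "even (nonneg_count a)") (auto simp: extreme_def)
  then have "extreme (of_int e) (of_int (- ?k) + of_int (e * int m))
      (signed_pow (- ?k) * (signed_pow ?k * two_products (map ((*) e) a)))"
    unfolding clear_denominators[OF e] using e by (intro extreme_mult extreme_signed_pow) auto
  moreover have "signed_pow (- ?k) * (signed_pow ?k * p) = p" for p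
    by (simp add: mult.assoc[symmetric] signed_pow_add[symmetric] signed_pow_0)
  moreover have "of_int (- ?k) + of_int (e * int m) =
      (of_int (e * (int m - int (nonneg_count a) - int (neg_part a) - 1)) :: rat)"
    by (simp add: algebra_simps)
  ultimately show ?thesis by (simp only:)
qed

lemma counts_mirror:
  "int (nonneg_count a) + int (nonneg_count (map uminus a)) = int (length a) + num_z a"
  "int (neg_part a) + int (neg_part (map uminus a)) = (\<Sum>x\<leftarrow>a. \<bar>x\<bar>)"
  by (induction a) (auto simp: nonneg_count_def neg_part_def num_z_def)

text \<open>The lowest exponent comes from \<open>cleared a\<close>, and the highest one, with the substitution \<open>y = - 1/t\<close>, from \<open>cleared (map uminus a)\<close>.
The shifts \<open>N + B + 1\<close> for \<open>a\<close> and \<open>- a\<close> add up to \<open>n + z + \<Sum>\<bar>a_i\<bar> + 2\<close>, and \<open>n\<close> is lost to the factors \<open>delta\<close>.\<close>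

lemma span_from_lowest_terms:
  assumes "a \<noteq> []" "low (cleared a) m c" "c \<noteq> 0" "low (cleared (map uminus a)) m' c'" "c' \<noteq> 0"
  shows "degree_span (jones (pretzel a) up) = of_int ((\<Sum>x\<leftarrow>a. \<bar>x\<bar>) + 2 + num_z a - int m - int m')"
proof -
  let ?a' = "map uminus a"
  have lo: "extreme 1 (of_int (int m - int (nonneg_count a) - int (neg_part a) - 1)) (two_products a)"
    using extreme_two_products[OF assms(2,3), of 1] by (simp add: map_idI)
  have "map ((*) (- 1)) ?a' = a" by (induction a) auto
  then have hi: "extreme (- 1) (of_int (- (int m' - int (nonneg_count ?a') - int (neg_part ?a') - 1))) (two_products a)"
    using extreme_two_products[OF assms(4,5), of "- 1"] by simp
  have "two_products a \<noteq> 0" using lo by (auto simp: extreme_def)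
  then have "degree_span (jones (pretzel a) up) =
      of_int (- (int m' - int (nonneg_count ?a') - int (neg_part ?a') - 1)
        - (int m - int (nonneg_count a) - int (neg_part a) - 1) - int (length a))"
    unfolding degree_span_jones[OF assms(1) \<open>two_products a \<noteq> 0\<close>] degree_span_extreme[OF lo hi] by simp
  also have "- (int m' - int (nonneg_count ?a') - int (neg_part ?a') - 1)
        - (int m - int (nonneg_count a) - int (neg_part a) - 1) - int (length a)
      = (\<Sum>x\<leftarrow>a. \<bar>x\<bar>) + 2 + num_z a - int m - int m'"
    using counts_mirror[of a] by simp
  finally show ?thesis .
qed

lemma cleared_mset: "mset a = mset b \<Longrightarrow> cleared a = cleared b"
proof -
  assume *: "mset a = mset b"
  have "(\<Prod>x\<leftarrow>a. f x) = (\<Prod>x\<leftarrow>b. f x)" for f :: "int \<Rightarrow> int poly"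
    using * by (metis mset_map prod_mset_prod_list)
  moreover have "nonneg_count a = nonneg_count b"
    using * unfolding nonneg_count_def by (metis mset_filter size_mset)
  ultimately show ?thesis by (simp add: cleared_def)
qed

section \<open>Lowest exponents of the cleared polynomial\<close>

definition lowest :: "int poly \<Rightarrow> nat \<Rightarrow> bool" where
  "lowest p m \<longleftrightarrow> (\<exists>c. c \<noteq> 0 \<and> low p m c)"

lemma lowestI: "low p m c \<Longrightarrow> c \<noteq> 0 \<Longrightarrow> lowest p m"
  by (auto simp: lowest_def)

lemma low_Y: "low Y 1 1"
  by (rule lowI[where q = 0]) simp

lemma low_Y_power: "low (Y ^ k) k 1"
  by (rule lowI[where q = 0]) simp

lemma low_U: "low U 0 1"
  by (rule lowI[where q = "Y - 1"]) (simp add: U_def algebra_simps power2_eq_square)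

lemma low_first_factor: "low (first_factor x) (if x = - 1 then 1 else 0) 1"
proof -
  consider "0 \<le> x" | "x = - 1" | "x \<le> - 2" by linarith
  then show ?thesis
  proof cases
    case 1
    then show ?thesis
      by (intro lowI[where q = "Y - 1 - Y ^ nat x"]) (simp add: first_factor_def U_def algebra_simps power2_eq_square)
  next
    case 2
    then show ?thesis
      by (intro lowI[where q = "- 1"]) (simp add: first_factor_def U_def algebra_simps power2_eq_square)
  next
    case 3
    define k where "k = nat (- x) - 2"
    have "nat (- x) - 1 = Suc k" using 3 by (simp add: k_def)
    then show ?thesis using 3
      by (intro lowI[where q = "- U * Y ^ k"]) (simp add: first_factor_def algebra_simps)
  qed
qed

lemma low_second_factor: "x \<noteq> 0 \<Longrightarrow> low (second_factor x) 0 1"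
proof -
  assume "x \<noteq> 0"
  then obtain k where "nat \<bar>x\<bar> = Suc k" by (cases "nat \<bar>x\<bar>") auto
  then show ?thesis by (intro lowI[where q = "- (Y ^ k)"]) (simp add: second_factor_def)
qed

text \<open>Only an entry \<open>- 1\<close> has a first factor without constant term: there it is \<open>1 - U = y (1 - y)\<close>.\<close>

lemma low_first_product: "low (\<Prod>x\<leftarrow>a. first_factor x) (count_list a (- 1)) 1"
proof -
  have "(\<Sum>x\<leftarrow>a. if x = - 1 then 1 else 0) = count_list a (- 1)"
    by (induction a) auto
  then show ?thesis
    using low_prod_list[of a first_factor "\<lambda>x. if x = - 1 then 1 else 0"] low_first_factor by simp
qed

lemma low_second_product: "0 \<notin> set a \<Longrightarrow> low (\<Prod>x\<leftarrow>a. second_factor x) 0 1"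
proof -
  assume "0 \<notin> set a"
  then have "low (second_factor x) 0 1" if "x \<in> set a" for x
    using low_second_factor[of x] that by metis
  from low_prod_list[OF this] show ?thesis by simp
qed

text \<open>An entry 0 has second factor \<open>1 - y^0 = 0\<close>.\<close>

lemma lowest_cleared_zero:
  assumes "0 \<in> set a"
  shows "lowest (cleared a) (count_list a (- 1) + 1)"
proof -
  have "(\<Prod>x\<leftarrow>a. second_factor x) = 0"
    using assms by (auto simp: prod_list_zero_iff second_factor_def image_iff intro!: bexI[of _ 0])
  then show ?thesis
    using lowestI[OF low_mult[OF low_Y low_first_product[of a]]] by (simp add: cleared_def)
qed

lemma lowest_cleared_generic:
  assumes "0 \<notin> set a" "nonneg_count a \<noteq> count_list a (- 1) + 1"
  shows "lowest (cleared a) (min (nonneg_count a) (count_list a (- 1) + 1))"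
proof -
  let ?p = "Y * (\<Prod>x\<leftarrow>a. first_factor x)" and ?q = "Y ^ nonneg_count a * U * (\<Prod>x\<leftarrow>a. second_factor x)"
  have p: "low ?p (count_list a (- 1) + 1) 1"
    using low_mult[OF low_Y low_first_product[of a]] by simp
  have q: "low (- ?q) (nonneg_count a) (- 1)"
    using low_minus[OF low_mult[OF low_mult[OF low_Y_power low_U] low_second_product[OF assms(1)]]] by simp
  have c: "cleared a = ?p + - ?q" by (simp add: cleared_def)
  show ?thesis
  proof (cases "count_list a (- 1) + 1 < nonneg_count a")
    case True
    then have "low (cleared a) (count_list a (- 1) + 1) 1"
      unfolding c using p q by (intro low_add_lt)
    then show ?thesis using True by (auto simp: min_def intro: lowestI)
  next
    case False
    then have "low (cleared a) (nonneg_count a) (- 1)"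
      unfolding c add.commute[of ?p] using p q assms(2) by (intro low_add_lt) auto
    moreover have "min (nonneg_count a) (count_list a (- 1) + 1) = nonneg_count a" using False by simp
    ultimately show ?thesis using lowestI by simp
  qed
qed

lemma products_split:
  assumes "\<forall>x\<in>set a. x \<noteq> 0 \<and> x \<noteq> 1"
  defines "as \<equiv> map nat (filter (\<lambda>x. x > 1) a)" and "bs \<equiv> map (\<lambda>x. nat (- x)) (filter (\<lambda>x. x < - 1) a)"
  shows "(\<Prod>x\<leftarrow>a. first_factor x) = pos_prod as * neg_prod bs * (Y * (1 - Y)) ^ count_list a (- 1) \<and>
    (\<Prod>x\<leftarrow>a. second_factor x) = pure_prod as * pure_prod bs * (1 - Y) ^ count_list a (- 1) \<and>
    nonneg_count a = length as"
  using assms(1) unfolding as_def bs_def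
proof (induction a)
  case Nil
  show ?case by (simp add: nonneg_count_def)
next
  case (Cons x a)
  have "x \<noteq> 0" "x \<noteq> 1" using Cons.prems by simp_all
  then have x: "x > 1 \<or> x < - 1 \<or> x = - 1" by linarith
  have one: "1 - U = Y * (1 - Y)" by (simp add: U_def algebra_simps power2_eq_square)
  let ?as = "map nat (filter (\<lambda>x. x > 1) a)" and ?bs = "map (\<lambda>x. nat (- x)) (filter (\<lambda>x. x < - 1) a)"
  have IH: "(\<Prod>x\<leftarrow>a. first_factor x) = pos_prod ?as * neg_prod ?bs * (Y * (1 - Y)) ^ count_list a (- 1)"
    "(\<Prod>x\<leftarrow>a. second_factor x) = pure_prod ?as * pure_prod ?bs * (1 - Y) ^ count_list a (- 1)"
    "length (filter (\<lambda>x. 0 \<le> x) a) = length ?as"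
    using Cons by (auto simp: nonneg_count_def)
  from x consider "x > 1" | "x < - 1" | "x = - 1" by blast
  then show ?case
  proof cases
    case 1
    then show ?thesis
      by (simp add: IH nonneg_count_def) (simp add: first_factor_def second_factor_def mult.assoc)
  next
    case 2
    then show ?thesis
      by (simp add: IH nonneg_count_def) (simp add: first_factor_def second_factor_def ac_simps)
  next
    case 3
    have "first_factor (- 1) = Y * (1 - Y)" "second_factor (- 1) = 1 - Y" by (simp_all add: first_factor_def second_factor_def one)
    then show ?thesis using 3
      by (simp add: IH nonneg_count_def)
  qed
qed

text \<open>Each entry \<open>- 1\<close> contributes \<open>y (1 - y)\<close> to the first and \<open>1 - y\<close> to the second product; with the common factor
\<open>y^N (1 - y)^(N - 1)\<close> removed, the difference is the one of \<open>low_several_positive\<close>.\<close>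

lemma lowest_cleared_several_positive:
  assumes "\<forall>x\<in>set a. x \<noteq> 0 \<and> x \<noteq> 1" "nonneg_count a = count_list a (- 1) + 1" "2 \<le> nonneg_count a"
  shows "lowest (cleared a) (nonneg_count a + 1)"
proof -
  define as where "as = map nat (filter (\<lambda>x. x > 1) a)"
  define bs where "bs = map (\<lambda>x. nat (- x)) (filter (\<lambda>x. x < - 1) a)"
  define N where "N = count_list a (- 1)"
  have sp: "(\<Prod>x\<leftarrow>a. first_factor x) = pos_prod as * neg_prod bs * (Y * (1 - Y)) ^ N"
    "(\<Prod>x\<leftarrow>a. second_factor x) = pure_prod as * pure_prod bs * (1 - Y) ^ N" "nonneg_count a = length as"
    using products_split[OF assms(1)] unfolding as_def bs_def N_def by blast+
  have "\<forall>a\<in>set as. 2 \<le> a" "\<forall>b\<in>set bs. 2 \<le> b" "2 \<le> length as"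
    using assms(3) sp(3) by (auto simp: as_def bs_def)
  then obtain c where c: "c \<noteq> 0" "low (pos_prod as * neg_prod bs - U * pure_prod as * pure_prod bs) 1 c"
    using low_several_positive by blast
  have N: "nonneg_count a = Suc N" using assms(2) by (simp add: N_def)
  have "low ((1 - Y) ^ k) 0 1" for k
  proof (induction k)
    case 0
    show ?case by (rule lowI[where q = 0]) simp
  next
    case (Suc k)
    have "low (1 - Y) 0 1" by (rule lowI[where q = "- 1"]) simp
    from low_mult[OF this Suc] show ?case by simp
  qed
  from low_mult[OF low_mult[OF low_Y_power[of "Suc N"] this[of N]] c(2)]
  have "low (Y ^ Suc N * (1 - Y) ^ N * (pos_prod as * neg_prod bs - U * pure_prod as * pure_prod bs)) (Suc N + 1) c"
    by simp
  moreover have "cleared a = Y ^ Suc N * (1 - Y) ^ N * (pos_prod as * neg_prod bs - U * pure_prod as * pure_prod bs)"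
    unfolding cleared_def sp(1,2) N power_mult_distrib by (simp add: algebra_simps)
  ultimately show ?thesis using c(1) by (auto simp: N intro: lowestI)
qed

lemma cleared_single_positive:
  assumes "1 \<le> x" "\<forall>b\<in>set bs. 1 \<le> b"
  shows "cleared (int x # map (\<lambda>b. - int b) bs) = Y * defect x bs"
proof -
  have "(\<Prod>b\<leftarrow>bs. first_factor (- int b)) = neg_prod bs"
    using assms(2) by (induction bs) (auto simp: first_factor_def)
  moreover have "(\<Prod>b\<leftarrow>bs. second_factor (- int b)) = pure_prod bs"
    by (induction bs) (auto simp: second_factor_def)
  moreover have "nonneg_count (map (\<lambda>b. - int b) bs) = 0"
    using assms(2) by (induction bs) (auto simp: nonneg_count_def)
  then have "nonneg_count (int x # map (\<lambda>b. - int b) bs) = 1"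
    by (simp add: nonneg_count_def)
  ultimately show ?thesis
    by (simp add: cleared_def o_def defect_def first_factor_def second_factor_def algebra_simps)
qed

text \<open>The order of \<open>defect x bs\<close> for sorted \<open>bs\<close>, all entries being at least 2.  A branch is left as soon as the next entry breaks the chain
\<open>x, x + 1, x + 2, ...\<close>; the numbers \<open>x + 3\<close>, \<open>6\<close> and \<open>3\<close> are the orders for \<open>[x + 1, x + 2]\<close>, and the last \<open>6\<close> is that for
\<open>x = 1\<close> and \<open>[2, 3, 4]\<close>.\<close>

definition defect_order :: "nat \<Rightarrow> nat list \<Rightarrow> nat" where
  "defect_order x bs = (case bs of [] \<Rightarrow> x | b1 # bs \<Rightarrow>
     if b1 \<noteq> x + 1 then min x (b1 - 1) else (case bs of [] \<Rightarrow> x + 1 | b2 # bs \<Rightarrow>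
     if b2 \<noteq> x + 2 then min (x + 1) (b2 - 1) else (case bs of
         [] \<Rightarrow> if x = 1 then 3 else if x = 2 then 6 else x + 3
       | b3 # bs \<Rightarrow>
     if x \<noteq> 1 then min (if x = 2 then 6 else x + 3) (b3 - 1)
     else if b3 \<noteq> 4 then min 3 (b3 - 1) else (case bs of [] \<Rightarrow> 6 | b4 # bs \<Rightarrow>
     if b4 = 4 then 3 else min 6 (b4 - 1)))))"

text \<open>The two competing lowest terms cancel only if they have the same order and the coefficient \<open>c\<close> equals the multiplicity of
\<open>n\<close>.  For \<open>c = - 1\<close> this is impossible; for \<open>c = 1\<close> it means that \<open>n\<close> occurs once.\<close>

lemma lowest_defect_append:
  assumes "1 \<le> x" "\<forall>b\<in>set pre. 2 \<le> b" "sorted (n # rest)" "2 \<le> n"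
    and l: "low (defect x pre) m c" "c \<noteq> 0" and "n - 1 \<noteq> m \<or> c \<noteq> int (count_list (n # rest) n)"
  shows "lowest (defect x (pre @ n # rest)) (min m (n - 1))"
proof -
  have *: "\<forall>b\<in>set (n # rest). n \<le> b" "n \<in> set (n # rest)" using assms(3) by auto
  note app = low_defect_append[OF assms(1,2) *(1) assms(4) *(2) l(1)]
  consider "n - 1 < m" | "n - 1 = m" | "n - 1 > m" by linarith
  then show ?thesis
  proof cases
    case 1
    then show ?thesis using lowestI[OF app(1)] by simp
  next
    case 2
    then show ?thesis using lowestI[OF app(2)] assms(7) by simp
  next
    case 3
    then show ?thesis using lowestI[OF app(3) l(2)] by simp
  qed
qed

lemma lowest_defect:
  assumes x: "1 \<le> x" and bs: "sorted bs" "\<forall>b\<in>set bs. 2 \<le> b"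
  shows "lowest (defect x bs) (defect_order x bs)"
proof (cases bs)
  case Nil
  then show ?thesis using lowestI[OF low_defect_0[of x]] by (simp add: defect_order_def)
next
  case bs1: (Cons b1 bs1)
  show ?thesis
  proof (cases "b1 = x + 1")
    case False
    have "lowest (defect x ([] @ b1 # bs1)) (min x (b1 - 1))"
      by (rule lowest_defect_append[OF x _ _ _ low_defect_0]) (use bs False bs1 in auto)
    then show ?thesis using False by (simp add: bs1 defect_order_def)
  next
    case b1: True
    show ?thesis
    proof (cases bs1)
      case Nil
      then show ?thesis using lowestI[OF low_defect_1[OF x]] by (simp add: defect_order_def bs1 b1)
    next
      case bs2: (Cons b2 bs2)
      show ?thesis
      proof (cases "b2 = x + 2")
        case False
        have "lowest (defect x ([Suc x] @ b2 # bs2)) (min (Suc x) (b2 - 1))"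
          by (rule lowest_defect_append[OF x _ _ _ low_defect_1[OF x]]) (use x bs False bs1 bs2 in auto)
        then show ?thesis using False by (simp add: bs1 bs2 b1 defect_order_def)
      next
        case b2: True
        show ?thesis
        proof (cases "x = 1")
          case x1: True
          have b12: "b1 = 2" "b2 = 3" using b1 b2 x1 by simp_all
          show ?thesis
          proof (cases bs2)
            case Nil
            then show ?thesis using lowestI[OF low_defect_2(1)]
              by (simp add: defect_order_def bs1 bs2 b12 x1)
          next
            case bs3: (Cons b3 bs3)
            show ?thesis
            proof (cases "b3 = 4")
              case False
              have "lowest (defect 1 ([2, 3] @ b3 # bs3)) (min 3 (b3 - 1))"
                by (rule lowest_defect_append[OF _ _ _ _ low_defect_2(1)]) (use bs False bs1 bs2 bs3 in auto)
              then show ?thesis using False by (simp add: bs1 bs2 bs3 b12 x1 defect_order_def)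
            next
              case b3: True
              show ?thesis
              proof (cases bs3)
                case Nil
                then show ?thesis using lowestI[OF low_defect_3]
                  by (simp add: defect_order_def bs1 bs2 b12 b3 x1 bs3)
              next
                case bs4: (Cons b4 bs4)
                show ?thesis
                proof (cases "b4 = 4")
                  case True
                  \<comment> \<open>The order 3 of \<open>[2, 3]\<close> has coefficient 1 and is met by at least two entries 4, so no cancellation.\<close>
                  have "lowest (defect 1 ([2, 3] @ 4 # 4 # bs4)) (min 3 (4 - 1))"
                    by (rule lowest_defect_append[OF _ _ _ _ low_defect_2(1)])
                       (use bs True b3 bs1 bs2 bs3 bs4 in auto)
                  then show ?thesis using True
                    by (simp add: bs1 bs2 bs3 bs4 b12 b3 x1 defect_order_def)
                next
                  case False
                  have "lowest (defect 1 ([2, 3, 4] @ b4 # bs4)) (min 6 (b4 - 1))"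
                    by (rule lowest_defect_append[OF _ _ _ _ low_defect_3])
                       (use bs b3 bs1 bs2 bs3 bs4 in auto)
                  then show ?thesis using False
                    by (simp add: bs1 bs2 bs3 bs4 b12 b3 x1 defect_order_def)
                qed
              qed
            qed
          qed
        next
          case False
          have base: "low (defect x [Suc x, Suc (Suc x)]) (if x = 2 then 6 else x + 3) (- 1)"
            using low_defect_2(2) low_defect_2(3)[of x] x False by (auto simp: eval_nat_numeral)
          show ?thesis
          proof (cases bs2)
            case Nil
            then show ?thesis using lowestI[OF base] False by (simp add: defect_order_def bs1 bs2 b1 b2)
          next
            case bs3: (Cons b3 bs3)
            have "lowest (defect x ([Suc x, Suc (Suc x)] @ b3 # bs3)) (min (if x = 2 then 6 else x + 3) (b3 - 1))"
              by (rule lowest_defect_append[OF x _ _ _ base]) (use x bs bs1 bs2 bs3 in auto)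
            then show ?thesis using False by (simp add: bs1 bs2 bs3 b1 b2 defect_order_def)
          qed
        qed
      qed
    qed
  qed
qed

lemma lowest_cleared_single_positive:
  assumes "mset a = mset (int x # map (\<lambda>b. - int b) bs)"
    and "1 \<le> x" "sorted bs" "\<forall>b\<in>set bs. 2 \<le> b"
  shows "lowest (cleared a) (Suc (defect_order x bs))"
proof -
  have "cleared a = Y * defect x bs"
    using cleared_mset[OF assms(1)] cleared_single_positive[of x bs] assms by fastforce
  moreover obtain c where "c \<noteq> 0" "low (defect x bs) (defect_order x bs) c"
    using lowest_defect[OF assms(2-4)] by (auto simp: lowest_def)
  ultimately show ?thesis
    using lowestI[OF low_mult[OF low_Y, of "defect x bs" "defect_order x bs" c]] by simp
qed

text \<open>\<open>cleared\<close> depends only on the multiset of entries, and passing to \<open>- a\<close> exchanges the roles of \<open>m\<close> and \<open>m'\<close>.\<close>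

lemma span_symmetric:
  assumes "b \<noteq> []" and ab: "mset a = mset b \<or> mset a = mset (map uminus b)"
    and m: "lowest (cleared a) m" "lowest (cleared (map uminus a)) m'"
  shows "degree_span (jones (pretzel b) up) = of_int ((\<Sum>x\<leftarrow>a. \<bar>x\<bar>) + 2 + num_z a - int m - int m')"
proof -
  obtain c c' where c: "c \<noteq> 0" "low (cleared a) m c" "c' \<noteq> 0" "low (cleared (map uminus a)) m' c'"
    using m by (auto simp: lowest_def)
  have sums: "(\<Sum>x\<leftarrow>a. \<bar>x\<bar>) = (\<Sum>x\<leftarrow>b. \<bar>x\<bar>)" "num_z a = num_z b"
  proof -
    have id: "(\<Sum>x\<leftarrow>c. f x) = (\<Sum>x\<leftarrow>d. f x)" if "mset c = mset d" for c d and f :: "int \<Rightarrow> int"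
      using that by (metis mset_map sum_mset_sum_list)
    have z: "num_z c = (\<Sum>x\<leftarrow>c. if x = 0 then 1 else 0)" for c
      by (induction c) (auto simp: num_z_def)
    have "(\<Sum>x\<leftarrow>map uminus b. \<bar>x\<bar>) = (\<Sum>x\<leftarrow>b. \<bar>x\<bar>)" by (simp add: o_def)
    then show "(\<Sum>x\<leftarrow>a. \<bar>x\<bar>) = (\<Sum>x\<leftarrow>b. \<bar>x\<bar>)"
      using ab id[of a b abs] id[of a "map uminus b" abs] by metis
    have "num_z (map uminus b) = num_z b" unfolding z by (simp add: o_def)
    then show "num_z a = num_z b"
      using ab id[of a b] id[of a "map uminus b"] unfolding z by metis
  qed
  from ab show ?thesis
  proof
    assume e: "mset a = mset b"
    then have "mset (map uminus a) = mset (map uminus b)" by simp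
    then show ?thesis
      using span_from_lowest_terms[OF assms(1), of m c m' c'] c cleared_mset e sums by metis
  next
    assume e: "mset a = mset (map uminus b)"
    then have "mset (map uminus a) = mset b" by (simp add: image_mset.compositionality o_def)
    then have "degree_span (jones (pretzel b) up) = of_int ((\<Sum>x\<leftarrow>b. \<bar>x\<bar>) + 2 + num_z b - int m' - int m)"
      using span_from_lowest_terms[OF assms(1), of m' c' m c] c cleared_mset e by metis
    then show ?thesis by (simp add: sums)
  qed
qed

section \<open>The spans\<close>

lemma mirror_counts:
  "count_list (map uminus a) (- 1 :: int) = count_list a 1"
  "int (nonneg_count a) = num_r a + num_alpha a + num_z a"
  "int (nonneg_count (map uminus a)) = num_s a + num_beta a + num_z a"
  "(\<Sum>x\<leftarrow>a. \<bar>x\<bar>) = num_Sigma a + num_alpha a + num_beta a"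
  by (induction a)
     (auto simp: nonneg_count_def num_r_def num_s_def num_alpha_def num_beta_def num_z_def num_Sigma_def)

text \<open>These are the sorted reduced diagrams with \<open>z = 0\<close>, \<open>r + \<lambda> = 1\<close> and \<open>r \<le> 1\<close>.\<close>

lemma single_positive_shape:
  assumes "sorted_wrt (\<ge>) a" "0 \<notin> set a" "- 1 \<notin> set a" "nonneg_count a = 1"
  obtains x bs where "a = int x # map (\<lambda>b. - int b) bs" "1 \<le> x" "sorted bs" "\<forall>b\<in>set bs. 2 \<le> b"
proof -
  obtain h t where a: "a = h # t" using assms(4) by (cases a) (auto simp: nonneg_count_def)
  have h: "h \<ge> 1"
  proof (rule ccontr)
    assume "\<not> h \<ge> 1"
    moreover have "h \<noteq> 0" using assms(2) a by auto
    ultimately have "\<forall>x\<in>set a. x < 0" using assms(1) a by fastforce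
    then have "filter (\<lambda>x. 0 \<le> x) a = []" by (simp add: filter_empty_conv not_le)
    then show False using assms(4) by (simp add: nonneg_count_def)
  qed
  then have "filter (\<lambda>x. 0 \<le> x) t = []" using assms(4) by (simp add: a nonneg_count_def)
  then have "\<forall>x\<in>set t. x < 0" by (simp add: filter_empty_conv not_le)
  then have t: "x \<le> - 2" if "x \<in> set t" for x
  proof -
    have "x < 0" "x \<noteq> - 1" using that assms(3) a \<open>\<forall>x\<in>set t. x < 0\<close> by auto
    then show ?thesis by linarith
  qed
  have "map (\<lambda>b. - int b) (map (\<lambda>x. nat (- x)) t) = map (\<lambda>x. x) t"
    unfolding map_map by (rule map_cong[OF refl]) (use t in fastforce)
  then have "a = int (nat h) # map (\<lambda>b. - int b) (map (\<lambda>x. nat (- x)) t)" using h a by simp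
  moreover have "sorted (map (\<lambda>x. nat (- x)) t)"
    unfolding sorted_wrt_map using assms(1) a by (auto intro: sorted_wrt_mono_rel[rotated])
  moreover have "\<forall>b\<in>set (map (\<lambda>x. nat (- x)) t). 2 \<le> b" using t by fastforce
  moreover have "1 \<le> nat h" using h by simp
  ultimately show ?thesis using that by blast
qed

lemma num_single_positive:
  assumes "1 \<le> x" "\<forall>b\<in>set bs. 2 \<le> b"
  defines "a \<equiv> int x # map (\<lambda>b. - int b) bs"
  shows "num_s a = int (length bs)" "num_r a = (if x = 1 then 0 else 1)"
    "num_Sigma a = (if x = 1 then 0 else int x) + int (sum_list bs)"
proof -
  have "num_s (map (\<lambda>b. - int b) bs) = int (length bs)" "num_r (map (\<lambda>b. - int b) bs) = 0"
    "num_Sigma (map (\<lambda>b. - int b) bs) = int (sum_list bs)"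
    using assms(2) by (induction bs) (auto simp: num_s_def num_r_def num_Sigma_def)
  then show "num_s a = int (length bs)" "num_r a = (if x = 1 then 0 else 1)"
    "num_Sigma a = (if x = 1 then 0 else int x) + int (sum_list bs)"
    using assms(1) by (auto simp: a_def num_s_def num_r_def num_Sigma_def)
qed

text \<open>Rewriting equations between rational spans into equations between integers.\<close>

lemma of_int_if:
  "(if c then of_int p else of_int q :: rat) = of_int (if c then p else q)"
  "(if c then numeral n else of_int q :: rat) = of_int (if c then numeral n else q)"
  by simp_all

lemmas rat_int_eq = of_int_if of_int_eq_iff of_int_eq_1_iff of_int_eq_numeral_iff

text \<open>The next lemmas evaluate \<open>defect_order\<close> in the cases of the theorem; \<open>T\<close> is the span.  Here the lowest terms cancel
only at the bottom, which costs exactly \<open>defect_order x bs\<close>.\<close>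

lemma spans_one_large_positive:
  fixes T :: int
  assumes a: "a = int x # map (\<lambda>b. - int b) bs" and x: "2 \<le> x" and bs: "sorted bs" "\<forall>b\<in>set bs. 2 \<le> b"
    and s: "s = int (length bs)" "s > 1" and Sig: "Sig = int x + int (sum_list bs)"
    and T: "T = Sig - int (defect_order x bs)"
  shows "(entry a 1 \<noteq> \<bar>entry a 2\<bar> - 1 \<longrightarrow>
             T = (Sig - min (entry a 1) (\<bar>entry a 2\<bar> - 1))) \<and>
          (entry a 1 = \<bar>entry a 2\<bar> - 1 \<and> \<bar>entry a 2\<bar> \<noteq> \<bar>entry a 3\<bar> - 1 \<longrightarrow>
             T = (Sig - min \<bar>entry a 2\<bar> (\<bar>entry a 3\<bar> - 1))) \<and>
          (s = 2 \<and> entry a 1 = \<bar>entry a 2\<bar> - 1 \<and> \<bar>entry a 2\<bar> = \<bar>entry a 3\<bar> - 1 \<longrightarrow>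
             T = (if a = [2, - 3, - 4] then 3 else 2 * entry a 1)) \<and>
          (length a \<ge> 4 \<and> entry a 1 = \<bar>entry a 2\<bar> - 1 \<and> \<bar>entry a 2\<bar> = \<bar>entry a 3\<bar> - 1 \<longrightarrow>
             (\<bar>entry a 3\<bar> < \<bar>entry a 4\<bar> - 1 \<longrightarrow>
                T = (if entry a 1 = 2 \<and> entry a 2 = - 3 \<and> entry a 3 = - 4 \<and> entry a 4 < - 6
                     then Sig - 6 else Sig - entry a 1 - 3)) \<and>
             (\<bar>entry a 3\<bar> = \<bar>entry a 4\<bar> - 1 \<longrightarrow> T = Sig - entry a 1 - 2) \<and>
             (\<bar>entry a 3\<bar> = \<bar>entry a 4\<bar> \<longrightarrow> T = Sig - entry a 1 - 1))"
proof -
  obtain b1 b2 bs2 where bs2: "bs = b1 # b2 # bs2"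
    using s by (cases bs; cases "tl bs") auto
  have o: "2 \<le> b1" "b1 \<le> b2" using bs by (auto simp: bs2)
  have e: "entry a 1 = int x" "entry a 2 = - int b1" "entry a 3 = - int b2" by (simp_all add: a bs2)
  show ?thesis
  proof (cases bs2)
    case Nil
    have l: "s = 2" "length a = 3" "a = [2, - 3, - 4] \<longleftrightarrow> x = 2 \<and> b1 = 3 \<and> b2 = 4"
      by (auto simp: s a bs2 Nil)
    have Sig': "Sig = int x + int b1 + int b2" by (simp add: Sig bs2 Nil)
    have D: "defect_order x bs = (if b1 \<noteq> x + 1 then min x (b1 - 1)
        else if b2 \<noteq> x + 2 then min (x + 1) (b2 - 1) else if x = 2 then 6 else x + 3)"
      using x by (simp add: defect_order_def bs2 Nil)
    consider "b1 \<noteq> x + 1" | "b1 = x + 1" "b2 \<noteq> x + 2" | "b1 = x + 1" "b2 = x + 2" by blast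
    then show ?thesis unfolding e l T Sig' D using o x by cases (auto simp: min_def)
  next
    case (Cons b3 bs3)
    have l: "s \<noteq> 2" "entry a 4 = - int b3"
      by (auto simp: s a bs2 Cons)
    have o3: "b2 \<le> b3" using bs by (simp add: bs2 Cons)
    have D: "defect_order x bs = (if b1 \<noteq> x + 1 then min x (b1 - 1)
        else if b2 \<noteq> x + 2 then min (x + 1) (b2 - 1) else min (if x = 2 then 6 else x + 3) (b3 - 1))"
      using x by (simp add: defect_order_def bs2 Cons)
    consider "b1 \<noteq> x + 1" | "b1 = x + 1" "b2 \<noteq> x + 2" | "b1 = x + 1" "b2 = x + 2" by blast
    then show ?thesis unfolding e l T D using o x l(1) o3 by cases (auto simp: min_def)
  qed
qed

text \<open>The last summand of \<open>T\<close> is the lowest exponent of \<open>cleared\<close> for \<open>- a\<close>: it is \<open>min s 2\<close> in general, and 3 for \<open>s = 2\<close>, where the terms cancel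
there as well.\<close>

lemma spans_one_unit_no_two:
  fixes T :: int
  assumes a: "a = int x # map (\<lambda>b. - int b) bs" and x: "x = 1" and bs: "sorted bs" "\<forall>b\<in>set bs. 2 \<le> b"
    and s: "s = int (length bs)" and Sig: "Sig = int (sum_list bs)"
    and two: "\<not> (length a \<ge> 2 \<and> entry a 2 = - 2)"
    and T: "T = (Sig + 2 - int (defect_order x bs) - (if s = 2 then 3 else min s 2))"
  shows "(s = 0 \<longrightarrow> T = Sig + 1 \<and> T = 1) \<and>
          (s = 1 \<longrightarrow> T = Sig \<and> T = - entry a 2) \<and>
          (s = 2 \<longrightarrow> T = Sig - 2) \<and>
          (s > 2 \<longrightarrow> T = Sig - 1)"
proof (cases bs)
  case Nil
  then show ?thesis using s Sig T x by (simp add: defect_order_def)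
next
  case (Cons b1 bs1)
  have b1: "3 \<le> b1" using bs(2) two by (auto simp: a Cons)
  then have "defect_order x bs = (if bs1 = [] then min 1 (b1 - 1) else 1)"
    by (auto simp: defect_order_def x Cons min_def)
  then have D: "defect_order x bs = 1" using b1 by simp
  have e: "entry a 2 = - int b1" by (simp add: a Cons)
  have l: "s = 1 \<longrightarrow> Sig = int b1" using s by (auto simp: Sig Cons)
  have "s \<ge> 1" using s by (simp add: Cons)
  then show ?thesis unfolding e T D using l by auto
qed

lemma spans_one_unit_two:
  fixes T :: int
  assumes a: "a = int x # map (\<lambda>b. - int b) bs" and x: "x = 1" and bs: "sorted bs" "\<forall>b\<in>set bs. 2 \<le> b"
    and s: "s = int (length bs)" and Sig: "Sig = int (sum_list bs)"
    and two: "length a \<ge> 2 \<and> entry a 2 = - 2"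
    and T: "T = (Sig + 2 - int (defect_order x bs) - (if s = 2 then 3 else min s 2))"
  shows "(s = 1 \<longrightarrow> T = Sig - 1 \<and> T = 1) \<and>
          (s = 2 \<and> entry a 3 = - 2 \<longrightarrow> T = Sig - 2 \<and> T = 2) \<and>
          (s = 2 \<and> entry a 3 = - 3 \<longrightarrow> T = Sig - 4 \<and> T = 1) \<and>
          (s = 2 \<and> entry a 3 < - 3 \<longrightarrow>
             T = Sig - 3 \<and> T = - 1 - entry a 3) \<and>
          (s = 3 \<and> entry a 3 = - 2 \<longrightarrow>
             T = Sig - 1 \<and> T = 3 - entry a 4) \<and>
          (s = 3 \<and> entry a 3 = - 3 \<and> entry a 4 = - 3 \<longrightarrow> T = Sig - 2 \<and> T = 6) \<and>
          (s = 3 \<and> entry a 3 = - 3 \<and> entry a 4 = - 4 \<longrightarrow> T = Sig - 6 \<and> T = 3) \<and>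
          (s = 3 \<and> entry a 3 = - 3 \<and> entry a 4 < - 4 \<longrightarrow>
             T = Sig - 3 \<and> T = 2 - entry a 4) \<and>
          (s = 3 \<and> entry a 3 < - 3 \<longrightarrow>
             T = Sig - 2 \<and> T = - entry a 3 - entry a 4) \<and>
          (s > 3 \<and> entry a 3 = - 2 \<longrightarrow> T = Sig - 1) \<and>
          (s > 3 \<and> entry a 3 = - 3 \<and> entry a 4 = - 3 \<longrightarrow> T = Sig - 2) \<and>
          (s > 3 \<and> entry a 3 = - 3 \<and> entry a 4 = - 4 \<and> entry a 5 = - 4 \<longrightarrow>
             T = Sig - 3) \<and>
          (s > 3 \<and> entry a 3 = - 3 \<and> entry a 4 = - 4 \<and> entry a 5 = - 5 \<longrightarrow>
             T = Sig - 4) \<and>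
          (s > 3 \<and> entry a 3 = - 3 \<and> entry a 4 = - 4 \<and> entry a 5 < - 5 \<longrightarrow>
             T = (if entry a 5 < - 6 then Sig - 6 else Sig - 5)) \<and>
          (s > 3 \<and> entry a 3 = - 3 \<and> entry a 4 < - 4 \<longrightarrow> T = Sig - 3) \<and>
          (s > 3 \<and> entry a 3 < - 3 \<longrightarrow> T = Sig - 2)"
proof -
  obtain bs1 where bs1: "bs = 2 # bs1" using two a by (cases bs) auto
  show ?thesis
  proof (cases bs1)
    case Nil
    then show ?thesis using s Sig T x by (simp add: defect_order_def bs1)
  next
    case bs2: (Cons b2 bs2)
    have o: "2 \<le> b2" using bs by (simp add: bs1 bs2)
    have e: "entry a 3 = - int b2" by (simp add: a bs1 bs2)
    show ?thesis
    proof (cases bs2)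
      case Nil
      have l: "s = 2" "Sig = 2 + int b2" by (simp_all add: s Sig bs1 bs2 Nil)
      have D: "defect_order x bs = (if b2 \<noteq> 3 then min 2 (b2 - 1) else 3)"
        by (simp add: defect_order_def numeral_2_eq_2 x bs1 bs2 Nil)
      show ?thesis unfolding e l T D using o by (auto simp: min_def)
    next
      case bs3: (Cons b3 bs3)
      have o3: "b2 \<le> b3" using bs by (simp add: bs1 bs2 bs3)
      have e3: "entry a 4 = - int b3" by (simp add: a bs1 bs2 bs3)
      show ?thesis
      proof (cases bs3)
        case Nil
        have l: "s = 3" "Sig = 2 + int b2 + int b3" by (simp_all add: s Sig bs1 bs2 bs3 Nil)
        have D: "defect_order x bs = (if b2 \<noteq> 3 then min 2 (b2 - 1) else if b3 \<noteq> 4 then min 3 (b3 - 1) else 6)"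
          by (simp add: defect_order_def numeral_2_eq_2 x bs1 bs2 bs3 Nil)
        show ?thesis unfolding e e3 l T D using o o3 by (auto simp: min_def)
      next
        case bs4: (Cons b4 bs4)
        have o4: "b3 \<le> b4" using bs by (simp add: bs1 bs2 bs3 bs4)
        have e4: "entry a 5 = - int b4" by (simp add: a bs1 bs2 bs3 bs4)
        have l: "s > 3" by (simp add: s bs1 bs2 bs3 bs4)
        have D: "defect_order x bs = (if b2 \<noteq> 3 then min 2 (b2 - 1) else if b3 \<noteq> 4 then min 3 (b3 - 1)
            else if b4 = 4 then 3 else min 6 (b4 - 1))"
          by (simp add: defect_order_def numeral_2_eq_2 x bs1 bs2 bs3 bs4)
        consider "b2 \<noteq> 3" | "b2 = 3" "b3 \<noteq> 4" | "b2 = 3" "b3 = 4" by blast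
        then show ?thesis unfolding e e3 e4 T D using o o3 o4 l by cases (auto simp: min_def)
      qed
    qed
  qed
qed

text \<open>Here both ends cancel: the bottom has two positive entries, the top is the bottom of \<open>P(1, - a_2, - a_1)\<close>.\<close>

lemma spans_two_positive:
  fixes T :: int
  assumes a: "a = [int a1, int a2, - 1]" and "2 \<le> a2" "a2 \<le> a1"
    and T: "T = Sig - 1 - int (defect_order 1 [a2, a1])" and Sig: "Sig = int a1 + int a2"
  shows "(entry a 2 = 2 \<and> entry a 1 = 2 \<longrightarrow> T = Sig - 2 \<and> T = 2) \<and>
             (entry a 2 = 2 \<and> entry a 1 = 3 \<longrightarrow> T = Sig - 4 \<and> T = 1) \<and>
             (entry a 2 = 2 \<and> entry a 1 > 3 \<longrightarrow>
                T = Sig - 3 \<and> T = entry a 1 - 1) \<and>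
             (entry a 2 > 2 \<longrightarrow>
                T = Sig - 2 \<and> T = entry a 1 + entry a 2 - 2)"
proof -
  have e: "entry a 1 = int a1" "entry a 2 = int a2" by (simp_all add: a)
  have D: "defect_order 1 [a2, a1] = (if a2 \<noteq> 2 then min 1 (a2 - 1) else if a1 \<noteq> 3 then min 2 (a1 - 1) else 3)"
    by (simp add: defect_order_def numeral_2_eq_2)
  show ?thesis unfolding e T Sig D using assms(2,3) by (auto simp: min_def)
qed

text \<open>For \<open>P(x, - b)\<close> both ends have one positive entry, and the two orders \<open>defect_order x [b]\<close> and \<open>defect_order b [x]\<close> enter
symmetrically.\<close>

lemma spans_one_large_positive_few:
  fixes T :: int
  assumes a: "a = int x # map (\<lambda>b. - int b) bs" and x: "2 \<le> x" and bs: "\<forall>b\<in>set bs. 2 \<le> b"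
    and s: "s = int (length bs)" "s \<le> 1" and Sig: "Sig = int x + int (sum_list bs)"
    and T: "T = (Sig + 1 - int (defect_order x bs) - (case bs of [] \<Rightarrow> 0 | b # _ \<Rightarrow> 1 + int (defect_order b [x])))"
  shows "(s = 0 \<longrightarrow> T = 1 \<and> T = Sig - entry a 1 + 1) \<and>
          (s = 1 \<and> \<bar>entry a 1 + entry a 2\<bar> = 0 \<longrightarrow> T = 2) \<and>
          (s = 1 \<and> \<bar>entry a 1 + entry a 2\<bar> = 1 \<longrightarrow> T = 1) \<and>
          (s = 1 \<and> \<bar>entry a 1 + entry a 2\<bar> > 1 \<longrightarrow>
             T = 1 + \<bar>entry a 1 + entry a 2\<bar>)"
proof (cases bs)
  case Nil
  then show ?thesis using s a Sig T by (simp add: defect_order_def)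
next
  case (Cons b1 bs1)
  then have bs1: "bs = [b1]" using s by simp
  have e: "entry a 1 = int x" "entry a 2 = - int b1" "s = 1" "Sig = int x + int b1"
    by (simp_all add: a bs1 s Sig)
  have D: "defect_order x bs = (if b1 \<noteq> x + 1 then min x (b1 - 1) else x + 1)"
    "(case bs of [] \<Rightarrow> 0 | b # _ \<Rightarrow> 1 + int (defect_order b [x])) =
      1 + int (if x \<noteq> b1 + 1 then min b1 (x - 1) else b1 + 1)"
    by (simp_all add: defect_order_def bs1)
  have "2 \<le> b1" using bs by (simp add: bs1)
  then show ?thesis unfolding e T D using x by (auto simp: min_def)
qed

lemma reduced_sorted_mirror:
  assumes "reduced b" and "mset a = mset b \<or> mset a = mset (map uminus b)" and "sorted_wrt (\<ge>) a"
  shows "reduced a"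
proof -
  have count: "count_list a x = count_list c x" if "mset a = mset c" for c x
    using that by (metis count_mset)
  have neg: "count_list (map uminus b) x = count_list b (- x)" for x
    by (induction b) auto
  from assms(2) have nums: "num_alpha a * num_beta a = num_alpha b * num_beta b \<and> num_z a = num_z b \<and>
      (num_alpha a = 0 \<and> num_beta a = 0 \<longleftrightarrow> num_alpha b = 0 \<and> num_beta b = 0)"
    unfolding num_alpha_def num_beta_def num_z_def
    by (elim disjE) (simp_all only: count neg, auto)
  show ?thesis
  proof (cases "b = [1, - 1]")
    case True
    have "a = [1, - 1]"
    proof -
      have m: "mset a = {#1, - 1#}" using assms(2) True by auto
      then have "length a = 2" by (metis size_mset size_add_mset size_empty numeral_2_eq_2)
      then obtain p q where "a = [p, q]" by (auto simp: length_Suc_conv numeral_2_eq_2)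
      then show ?thesis using m assms(3) by (auto simp: add_eq_conv_ex)
    qed
    then show ?thesis by (simp add: reduced_def)
  next
    case False
    then show ?thesis
      using assms(1) nums unfolding reduced_def by auto
  qed
qed

lemma length_counts: "int (length a) = num_r a + num_s a + num_alpha a + num_beta a + num_z a"
  by (induction a) (auto simp: num_r_def num_s_def num_alpha_def num_beta_def num_z_def)

lemma two_positive_shape:
  assumes "sorted_wrt (\<ge>) a"
    and "num_r a = 2" "num_s a = 0" "num_alpha a = 0" "num_beta a = 1" "num_z a = 0"
  obtains a1 a2 where "a = [int a1, int a2, - 1]" "2 \<le> a2" "a2 \<le> a1"
proof -
  have "length a = 3" using length_counts[of a] assms by simp
  then obtain p q t where a: "a = [p, q, t]" by (auto simp: length_Suc_conv numeral_3_eq_3)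
  then have o: "p \<ge> q" "q \<ge> t" using assms(1) by auto
  then have "t = - 1" "q > 1"
    using assms(2,5) unfolding a num_r_def num_beta_def by (auto split: if_splits)
  then have "a = [int (nat p), int (nat q), - 1]" "2 \<le> nat q" "nat q \<le> nat p"
    using o by (auto simp: a)
  then show ?thesis using that by blast
qed

theorem theorem9:
  fixes a b :: "int list" and up :: "pretzel_point \<Rightarrow> bool"
    and S :: rat and r s z lam Sig :: int
  assumes "b \<noteq> []"
    and "reduced b"
    and "orientation (pretzel b) up"
    and "S = degree_span (jones (pretzel b) up)"
    and "mset a = mset b \<or> mset a = mset (map uminus b)"
    and "sorted_wrt (\<ge>) a"
    and "r = num_r a" and "s = num_s a" and "z = num_z a"
    and "lam = num_lambda a" and "Sig = num_Sigma a"
  shows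
    "(z > 0 \<longrightarrow> S = of_int (Sig + z)) \<and>
     (z = 0 \<and> r + lam \<noteq> 1 \<and> s - lam \<noteq> 1 \<longrightarrow>
        S = (if a = [1, - 1] then 2 else of_int (Sig - Min {1, r + lam, s - lam} + 1))) \<and>
     (z = 0 \<and> r + lam = 1 \<longrightarrow>
       (r > 1 \<longrightarrow>
          ((r, lam, s) \<noteq> (2, - 1, 0) \<longrightarrow> S = of_int (Sig - 1)) \<and>
          ((r, lam, s) = (2, - 1, 0) \<longrightarrow>
             (entry a 2 = 2 \<and> entry a 1 = 2 \<longrightarrow> S = of_int (Sig - 2) \<and> S = 2) \<and>
             (entry a 2 = 2 \<and> entry a 1 = 3 \<longrightarrow> S = of_int (Sig - 4) \<and> S = 1) \<and>
             (entry a 2 = 2 \<and> entry a 1 > 3 \<longrightarrow>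
                S = of_int (Sig - 3) \<and> S = of_int (entry a 1 - 1)) \<and>
             (entry a 2 > 2 \<longrightarrow>
                S = of_int (Sig - 2) \<and> S = of_int (entry a 1 + entry a 2 - 2)))) \<and>
       (r = 1 \<and> s \<le> 1 \<longrightarrow>
          (s = 0 \<longrightarrow> S = 1 \<and> S = of_int (Sig - entry a 1 + 1)) \<and>
          (s = 1 \<and> \<bar>entry a 1 + entry a 2\<bar> = 0 \<longrightarrow> S = 2) \<and>
          (s = 1 \<and> \<bar>entry a 1 + entry a 2\<bar> = 1 \<longrightarrow> S = 1) \<and>
          (s = 1 \<and> \<bar>entry a 1 + entry a 2\<bar> > 1 \<longrightarrow>
             S = of_int (1 + \<bar>entry a 1 + entry a 2\<bar>))) \<and>
       (r = 1 \<and> s > 1 \<longrightarrow>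
          (entry a 1 \<noteq> \<bar>entry a 2\<bar> - 1 \<longrightarrow>
             S = of_int (Sig - min (entry a 1) (\<bar>entry a 2\<bar> - 1))) \<and>
          (entry a 1 = \<bar>entry a 2\<bar> - 1 \<and> \<bar>entry a 2\<bar> \<noteq> \<bar>entry a 3\<bar> - 1 \<longrightarrow>
             S = of_int (Sig - min \<bar>entry a 2\<bar> (\<bar>entry a 3\<bar> - 1))) \<and>
          (s = 2 \<and> entry a 1 = \<bar>entry a 2\<bar> - 1 \<and> \<bar>entry a 2\<bar> = \<bar>entry a 3\<bar> - 1 \<longrightarrow>
             S = (if a = [2, - 3, - 4] then 3 else of_int (2 * entry a 1))) \<and>
          (length a \<ge> 4 \<and> entry a 1 = \<bar>entry a 2\<bar> - 1 \<and> \<bar>entry a 2\<bar> = \<bar>entry a 3\<bar> - 1 \<longrightarrow>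
             (\<bar>entry a 3\<bar> < \<bar>entry a 4\<bar> - 1 \<longrightarrow>
                S = (if entry a 1 = 2 \<and> entry a 2 = - 3 \<and> entry a 3 = - 4 \<and> entry a 4 < - 6
                     then of_int (Sig - 6) else of_int (Sig - entry a 1 - 3))) \<and>
             (\<bar>entry a 3\<bar> = \<bar>entry a 4\<bar> - 1 \<longrightarrow> S = of_int (Sig - entry a 1 - 2)) \<and>
             (\<bar>entry a 3\<bar> = \<bar>entry a 4\<bar> \<longrightarrow> S = of_int (Sig - entry a 1 - 1)))) \<and>
       (r = 0 \<and> \<not> (length a \<ge> 2 \<and> entry a 2 = - 2) \<longrightarrow>
          (s = 0 \<longrightarrow> S = of_int (Sig + 1) \<and> S = 1) \<and>
          (s = 1 \<longrightarrow> S = of_int Sig \<and> S = of_int (- entry a 2)) \<and>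
          (s = 2 \<longrightarrow> S = of_int (Sig - 2)) \<and>
          (s > 2 \<longrightarrow> S = of_int (Sig - 1))) \<and>
       (r = 0 \<and> length a \<ge> 2 \<and> entry a 2 = - 2 \<longrightarrow>
          (s = 1 \<longrightarrow> S = of_int (Sig - 1) \<and> S = 1) \<and>
          (s = 2 \<and> entry a 3 = - 2 \<longrightarrow> S = of_int (Sig - 2) \<and> S = 2) \<and>
          (s = 2 \<and> entry a 3 = - 3 \<longrightarrow> S = of_int (Sig - 4) \<and> S = 1) \<and>
          (s = 2 \<and> entry a 3 < - 3 \<longrightarrow>
             S = of_int (Sig - 3) \<and> S = of_int (- 1 - entry a 3)) \<and>
          (s = 3 \<and> entry a 3 = - 2 \<longrightarrow>
             S = of_int (Sig - 1) \<and> S = of_int (3 - entry a 4)) \<and>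
          (s = 3 \<and> entry a 3 = - 3 \<and> entry a 4 = - 3 \<longrightarrow> S = of_int (Sig - 2) \<and> S = 6) \<and>
          (s = 3 \<and> entry a 3 = - 3 \<and> entry a 4 = - 4 \<longrightarrow> S = of_int (Sig - 6) \<and> S = 3) \<and>
          (s = 3 \<and> entry a 3 = - 3 \<and> entry a 4 < - 4 \<longrightarrow>
             S = of_int (Sig - 3) \<and> S = of_int (2 - entry a 4)) \<and>
          (s = 3 \<and> entry a 3 < - 3 \<longrightarrow>
             S = of_int (Sig - 2) \<and> S = of_int (- entry a 3 - entry a 4)) \<and>
          (s > 3 \<and> entry a 3 = - 2 \<longrightarrow> S = of_int (Sig - 1)) \<and>
          (s > 3 \<and> entry a 3 = - 3 \<and> entry a 4 = - 3 \<longrightarrow> S = of_int (Sig - 2)) \<and>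
          (s > 3 \<and> entry a 3 = - 3 \<and> entry a 4 = - 4 \<and> entry a 5 = - 4 \<longrightarrow>
             S = of_int (Sig - 3)) \<and>
          (s > 3 \<and> entry a 3 = - 3 \<and> entry a 4 = - 4 \<and> entry a 5 = - 5 \<longrightarrow>
             S = of_int (Sig - 4)) \<and>
          (s > 3 \<and> entry a 3 = - 3 \<and> entry a 4 = - 4 \<and> entry a 5 < - 5 \<longrightarrow>
             S = (if entry a 5 < - 6 then of_int (Sig - 6) else of_int (Sig - 5))) \<and>
          (s > 3 \<and> entry a 3 = - 3 \<and> entry a 4 < - 4 \<longrightarrow> S = of_int (Sig - 3)) \<and>
          (s > 3 \<and> entry a 3 < - 3 \<longrightarrow> S = of_int (Sig - 2))))"
proof -
  let "_ \<and> _ \<and> (_ \<longrightarrow> ?C3 \<and> ?C4 \<and> ?C5 \<and> ?C6 \<and> ?C7)" = ?thesis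
  let "_ \<longrightarrow> _ \<and> (_ \<longrightarrow> ?B3)" = ?C3
  let "_ \<longrightarrow> ?B4" = ?C4
  let "_ \<longrightarrow> ?B5" = ?C5
  let "_ \<longrightarrow> ?B6" = ?C6
  let "_ \<longrightarrow> ?B7" = ?C7
  define al be where "al = num_alpha a" and "be = num_beta a"
  have cnt: "int (nonneg_count a) = r + al + z" "int (nonneg_count (map uminus a)) = s + be + z"
    "int (count_list a (- 1)) = be" "int (count_list (map uminus a) (- 1)) = al"
    "(\<Sum>x\<leftarrow>a. \<bar>x\<bar>) = Sig + al + be" "lam = al - be"
    using mirror_counts[of a] assms(7-11)
    by (simp_all add: al_def be_def num_beta_def num_alpha_def num_lambda_def)
  have nn: "0 \<le> r" "0 \<le> s" "0 \<le> al" "0 \<le> be" "0 \<le> z"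
    using assms(7-9) by (simp_all add: al_def be_def num_r_def num_s_def num_alpha_def num_beta_def num_z_def)
  have S: "S = of_int (Sig + al + be + 2 + z - int m - int m')"
    if "lowest (cleared a) m" "lowest (cleared (map uminus a)) m'" for m m'
    using span_symmetric[OF assms(1,5) that] assms(4,9) cnt(5) by simp
  have mem: "0 \<in> set a \<longleftrightarrow> z \<noteq> 0" "0 \<in> set (map uminus a) \<longleftrightarrow> z \<noteq> 0"
    "1 \<in> set a \<longleftrightarrow> al \<noteq> 0" "- 1 \<in> set a \<longleftrightarrow> be \<noteq> 0"
    using count_list_0_iff[of a] assms(9)
    by (auto simp: al_def be_def num_alpha_def num_beta_def num_z_def image_iff)
  have red: "a = [1, - 1] \<or> al * be = 0 \<and> (z \<noteq> 0 \<longrightarrow> al = 0 \<and> be = 0)"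
    using reduced_sorted_mirror[OF assms(2,5,6)] assms(9) by (simp add: reduced_def al_def be_def)
  have zero: "z > 0 \<longrightarrow> S = of_int (Sig + z)"
  proof
    assume z: "z > 0"
    then have "a \<noteq> [1, - 1]" using assms(9) by (auto simp: num_z_def)
    then have ab: "al = 0" "be = 0" using red z by auto
    have "0 \<in> set a" "0 \<in> set (map uminus a)" using mem z by auto
    from S[OF this[THEN lowest_cleared_zero]] show "S = of_int (Sig + z)"
      using ab cnt by simp
  qed
  have generic: "S = (if a = [1, - 1] then 2 else of_int (Sig - Min {1, r + lam, s - lam} + 1))"
    if z: "z = 0" and "r + lam \<noteq> 1" "s - lam \<noteq> 1"
  proof -
    have "0 \<notin> set a" "0 \<notin> set (map uminus a)" using mem z by auto
    moreover have "nonneg_count a \<noteq> count_list a (- 1) + 1"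
      "nonneg_count (map uminus a) \<noteq> count_list (map uminus a) (- 1) + 1"
      using that cnt by linarith+
    ultimately have "S = of_int (Sig + al + be + 2 + z - int (min (nonneg_count a) (count_list a (- 1) + 1))
        - int (min (nonneg_count (map uminus a)) (count_list (map uminus a) (- 1) + 1)))"
      by (intro S lowest_cleared_generic)
    then have S': "S = of_int (Sig + al + be + 2 - min (r + al) (be + 1) - min (s + be) (al + 1))"
      using cnt z by (simp add: of_nat_min)
    show ?thesis
    proof (cases "a = [1, - 1]")
      case True
      then have "al = 1" "be = 1" "r = 0" "s = 0" "Sig = 0"
        using assms(7-11) by (simp_all add: al_def be_def num_alpha_def num_beta_def num_r_def num_s_def num_Sigma_def)
      then show ?thesis using True S' by simp
    next
      case False
      have "a \<noteq> []" using assms(1,5) by auto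
      then have "r + s + al + be \<noteq> 0"
        using z nn cnt(1,2) mem by (cases a) (auto simp: nonneg_count_def split: if_splits)
      moreover have "al = 0 \<or> be = 0" using red False by simp
      ultimately have "Sig + al + be + 2 - min (r + al) (be + 1) - min (s + be) (al + 1)
          = Sig - min 1 (min (r + lam) (s - lam)) + 1"
        using that nn unfolding cnt(6) by (auto simp: min_def)
      then show ?thesis using S' False by simp
    qed
  qed
  have several: "S = of_int (Sig - 1)"
    if z: "z = 0" and "r + lam = 1" "r > 1" "(r, lam, s) \<noteq> (2, - 1, 0)"
  proof -
    have "a \<noteq> [1, - 1]" using that assms(7) by (auto simp: num_r_def)
    then have ab: "al = 0" "be = r - 1" using red that nn cnt(6) by auto
    have sb: "s + be \<noteq> 1"
    proof
      assume "s + be = 1"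
      then have "r = 2" "s = 0" "lam = - 1" using that(3) ab nn(2) cnt(6) by linarith+
      then show False using that(4) by simp
    qed
    have "\<forall>x\<in>set a. x \<noteq> 0 \<and> x \<noteq> 1" using mem z ab by auto
    then have "lowest (cleared a) (nonneg_count a + 1)"
      using that ab cnt by (intro lowest_cleared_several_positive) linarith+
    moreover have "0 \<notin> set (map uminus a)" using mem z by auto
    then have "lowest (cleared (map uminus a))
        (min (nonneg_count (map uminus a)) (count_list (map uminus a) (- 1) + 1))"
      using that ab cnt by (intro lowest_cleared_generic) (use sb in linarith)+
    moreover have "min (nonneg_count (map uminus a)) (count_list (map uminus a) (- 1) + 1) = 1"
      using that ab cnt nn by linarith
    ultimately show ?thesis using S[of "nonneg_count a + 1" 1] ab cnt z by simp
  qed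
  have two: "S = of_int (Sig - 1 - int (defect_order 1 [a2, a1])) \<and> Sig = int a1 + int a2"
    if z: "z = 0" and rls: "r = 2" "lam = - 1" "s = 0" and a: "a = [int a1, int a2, - 1]" "2 \<le> a2" "a2 \<le> a1" for a1 a2
  proof -
    have ab: "al = 0" "be = 1" using a by (auto simp: al_def be_def num_alpha_def num_beta_def)
    have "\<forall>x\<in>set a. x \<noteq> 0 \<and> x \<noteq> 1" using mem z ab by auto
    then have "lowest (cleared a) (nonneg_count a + 1)"
      using rls z ab cnt by (intro lowest_cleared_several_positive) linarith+
    moreover have "lowest (cleared (map uminus a)) (Suc (defect_order 1 [a2, a1]))"
      by (rule lowest_cleared_single_positive) (use a in auto)
    moreover have "Sig = int a1 + int a2" using a assms(11) by (simp add: num_Sigma_def)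
    ultimately show ?thesis using S[of "nonneg_count a + 1" "Suc (defect_order 1 [a2, a1])"] rls ab cnt z
      by simp
  qed
  have single: "\<exists>x bs. a = int x # map (\<lambda>b. - int b) bs \<and> 1 \<le> x \<and> sorted bs \<and> (\<forall>b\<in>set bs. 2 \<le> b) \<and>
      s = int (length bs) \<and> r = (if x = 1 then 0 else 1) \<and> Sig = (if x = 1 then 0 else int x) + int (sum_list bs) \<and>
      al = 1 - r \<and> be = 0 \<and> lowest (cleared a) (Suc (defect_order x bs))"
    if z: "z = 0" and "r + lam = 1" "r \<le> 1"
  proof -
    have "a \<noteq> [1, - 1]"
      using that(2) assms(7,10) by (auto simp: num_r_def num_lambda_def num_alpha_def num_beta_def)
    then have "al = 0 \<or> be = 0" using red by simp
    then have ab: "be = 0" "al = 1 - r" using that(2,3) nn cnt(6) by linarith+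
    then have "nonneg_count a = 1" using cnt(1) z by linarith
    moreover have "0 \<notin> set a" "- 1 \<notin> set a" using mem z ab by auto
    ultimately obtain x bs where x: "a = int x # map (\<lambda>b. - int b) bs" "1 \<le> x" "sorted bs" "\<forall>b\<in>set bs. 2 \<le> b"
      using single_positive_shape[OF assms(6)] by metis
    have "lowest (cleared a) (Suc (defect_order x bs))"
      by (rule lowest_cleared_single_positive) (use x in auto)
    then show ?thesis
      using x ab num_single_positive[OF x(2,4)] assms(7-11) by (intro exI[of _ x] exI[of _ bs]) simp
  qed
  \<comment> \<open>The top of the polynomial is the bottom for \<open>- a\<close>, where the terms cancel only if \<open>s - lam = 1\<close>.\<close>
  have mirror_generic: "lowest (cleared (map uminus a)) (nat (min (s + be) (al + 1)))"
    if "z = 0" "s + be \<noteq> al + 1"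
  proof -
    have "0 \<notin> set (map uminus a)" using mem that by auto
    then have "lowest (cleared (map uminus a))
        (min (nonneg_count (map uminus a)) (count_list (map uminus a) (- 1) + 1))"
      using that cnt by (intro lowest_cleared_generic) linarith+
    moreover have "min (nonneg_count (map uminus a)) (count_list (map uminus a) (- 1) + 1) = nat (min (s + be) (al + 1))"
      using that cnt by (simp add: min_def) linarith
    ultimately show ?thesis by simp
  qed
  have g3: "?C3" if z: "z = 0" "r + lam = 1"
  proof (rule impI, rule conjI)
    assume r: "r > 1"
    show "(r, lam, s) \<noteq> (2, - 1, 0) \<longrightarrow> S = of_int (Sig - 1)"
      using several z r by blast
    show "(r, lam, s) = (2, - 1, 0) \<longrightarrow> ?B3"
    proof
      assume rls: "(r, lam, s) = (2, - 1, 0)"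
      obtain a1 a2 where a: "a = [int a1, int a2, - 1]" "2 \<le> a2" "a2 \<le> a1"
      proof (rule two_positive_shape[OF assms(6)])
        have "a \<noteq> [1, - 1]" using r assms(7) by (auto simp: num_r_def)
        then have "al = 0" "be = 1" using red rls cnt(6) nn by auto
        then show "num_r a = 2" "num_s a = 0" "num_alpha a = 0" "num_beta a = 1" "num_z a = 0"
          using rls z(1) assms(7-9) by (simp_all add: al_def be_def)
      qed
      from two[OF z(1) _ _ _ a] rls have S2: "S = of_int (Sig - 1 - int (defect_order 1 [a2, a1]))"
        and Sig: "Sig = int a1 + int a2" by auto
      define T where T: "T = Sig - 1 - int (defect_order 1 [a2, a1])"
      have ST: "S = of_int T" using S2 T by simp
      show "?B3" unfolding ST rat_int_eq
        by (rule spans_two_positive[OF a T Sig])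
    qed
  qed
  have g4: "?C4" if z: "z = 0" "r + lam = 1"
  proof
    assume rs: "r = 1 \<and> s \<le> 1"
    then obtain x bs where x: "a = int x # map (\<lambda>b. - int b) bs" "1 \<le> x" "sorted bs" "\<forall>b\<in>set bs. 2 \<le> b"
      "s = int (length bs)" "r = (if x = 1 then 0 else 1)" "Sig = (if x = 1 then 0 else int x) + int (sum_list bs)"
      "al = 1 - r" "be = 0" and lo: "lowest (cleared a) (Suc (defect_order x bs))"
      using single[OF z] by auto
    have x2: "2 \<le> x" using x(2,6) rs by (auto split: if_splits)
    define T where T: "T = Sig + 1 - int (defect_order x bs) -
      (case bs of [] \<Rightarrow> 0 | b # _ \<Rightarrow> 1 + int (defect_order b [x]))"
    have ST: "S = of_int T"
    proof (cases bs)
      case Nil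
      then show ?thesis using S[OF lo mirror_generic] x rs z by (simp add: T)
    next
      case (Cons b bs')
      then have b: "bs = [b]" using x(5) rs by simp
      have "lowest (cleared (map uminus a)) (Suc (defect_order b [x]))"
        by (rule lowest_cleared_single_positive) (use x x2 b in auto)
      from S[OF lo this] show ?thesis using x rs z b by (simp add: T)
    qed
    have sig: "Sig = int x + int (sum_list bs)" using x2 x(7) by simp
    show "?B4" unfolding ST rat_int_eq
      using spans_one_large_positive_few[OF x(1) x2 x(4,5) _ sig T] rs by blast
  qed
  have g5: "?C5" if z: "z = 0" "r + lam = 1"
  proof
    assume rs: "r = 1 \<and> s > 1"
    then obtain x bs where x: "a = int x # map (\<lambda>b. - int b) bs" "1 \<le> x" "sorted bs" "\<forall>b\<in>set bs. 2 \<le> b"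
      "s = int (length bs)" "r = (if x = 1 then 0 else 1)" "Sig = (if x = 1 then 0 else int x) + int (sum_list bs)"
      "al = 1 - r" "be = 0" and lo: "lowest (cleared a) (Suc (defect_order x bs))"
      using single[OF z] by auto
    have x2: "2 \<le> x" using x(2,6) rs by (auto split: if_splits)
    define T where T: "T = Sig - int (defect_order x bs)"
    have ST: "S = of_int T"
      using S[OF lo mirror_generic] x(8,9) rs z by (simp add: T min_def)
    have sig: "Sig = int x + int (sum_list bs)" using x2 x(7) by simp
    show "?B5" unfolding ST rat_int_eq
      by (rule spans_one_large_positive[OF x(1) x2 x(3-5) conjunct2[OF rs] sig T])
  qed
  have unit: "\<exists>x bs T. a = int x # map (\<lambda>b. - int b) bs \<and> x = 1 \<and> sorted bs \<and> (\<forall>b\<in>set bs. 2 \<le> b) \<and>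
      s = int (length bs) \<and> Sig = int (sum_list bs) \<and> S = of_int T \<and>
      T = Sig + 2 - int (defect_order x bs) - (if s = 2 then 3 else min s 2)"
    if z: "z = 0" "r + lam = 1" and r: "r = 0"
  proof -
    obtain x bs where x: "a = int x # map (\<lambda>b. - int b) bs" "1 \<le> x" "sorted bs" "\<forall>b\<in>set bs. 2 \<le> b"
      "s = int (length bs)" "r = (if x = 1 then 0 else 1)" "Sig = (if x = 1 then 0 else int x) + int (sum_list bs)"
      "al = 1 - r" "be = 0" and lo: "lowest (cleared a) (Suc (defect_order x bs))"
      using single[OF z] r by auto
    have x1: "x = 1" using x(6) r by (auto split: if_splits)
    have "S = of_int (Sig + 2 - int (defect_order x bs) - (if s = 2 then 3 else min s 2))"
    \<comment> \<open>For \<open>s = 2\<close> the terms cancel at the top as well: \<open>- a\<close> has two positive entries.\<close>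
    proof (cases "s = 2")
      case False
      then show ?thesis using S[OF lo mirror_generic] x(8,9) r z nn(2) by simp
    next
      case True
      have "- 1 \<notin> set a" "0 \<notin> set a" using mem z(1) x(9) by auto
      then have "\<forall>x\<in>set (map uminus a). x \<noteq> 0 \<and> x \<noteq> 1" by (auto simp: minus_equation_iff[of _ 1])
      then have "lowest (cleared (map uminus a)) (nonneg_count (map uminus a) + 1)"
        using True cnt(2,4) x(8,9) r z(1) by (intro lowest_cleared_several_positive) linarith+
      then show ?thesis using S[OF lo, of "nonneg_count (map uminus a) + 1"] True cnt(2,4) x(8,9) r z(1)
        by simp
    qed
    then show ?thesis using x x1 by auto
  qed
  have g6: "?C6" if z: "z = 0" "r + lam = 1"
  proof
    assume r: "r = 0 \<and> \<not> (length a \<ge> 2 \<and> entry a 2 = - 2)"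
    obtain x bs T where x: "a = int x # map (\<lambda>b. - int b) bs" "x = 1" "sorted bs" "\<forall>b\<in>set bs. 2 \<le> b"
      "s = int (length bs)" "Sig = int (sum_list bs)" and ST: "S = of_int T"
      and T: "T = Sig + 2 - int (defect_order x bs) - (if s = 2 then 3 else min s 2)"
      using unit[OF z conjunct1[OF r]] by blast
    show "?B6" unfolding ST rat_int_eq
      by (rule spans_one_unit_no_two[OF x conjunct2[OF r] T])
  qed
  have g7: "?C7" if z: "z = 0" "r + lam = 1"
  proof
    assume r: "r = 0 \<and> length a \<ge> 2 \<and> entry a 2 = - 2"
    obtain x bs T where x: "a = int x # map (\<lambda>b. - int b) bs" "x = 1" "sorted bs" "\<forall>b\<in>set bs. 2 \<le> b"
      "s = int (length bs)" "Sig = int (sum_list bs)" and ST: "S = of_int T"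
      and T: "T = Sig + 2 - int (defect_order x bs) - (if s = 2 then 3 else min s 2)"
      using unit[OF z conjunct1[OF r]] by blast
    show "?B7" unfolding ST rat_int_eq
      by (rule spans_one_unit_two[OF x conjunct2[OF r] T])
  qed
  show ?thesis
  proof (rule conjI[OF zero conjI[OF impI impI]])
    assume "z = 0 \<and> r + lam \<noteq> 1 \<and> s - lam \<noteq> 1"
    then show "S = (if a = [1, - 1] then 2 else of_int (Sig - Min {1, r + lam, s - lam} + 1))"
      using generic by blast
  next
    assume z: "z = 0 \<and> r + lam = 1"
    note g = g3 g4 g5 g6 g7
    note g = g[OF conjunct1[OF z] conjunct2[OF z]]
    show "?C3 \<and> ?C4 \<and> ?C5 \<and> ?C6 \<and> ?C7" by (rule conjI[OF g(1) conjI[OF g(2) conjI[OF g(3) conjI[OF g(4) g(5)]]]])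
  qed
qed

end
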